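(* Let $\mu$ be a polynomial-time computable monotone function. Then for every fixed $q$, there is an $n^{O(q)}m$ time algorithm for the $(\mu,p,q)$-Partition problem, where $n$ and $m$ denote the number of vertices and edges of the input graph (and $p$ is part of the input).
   Context: Here $\mu$ assigns a nonnegative integer to each subset of vertices of a graph $G$; it is monotone if $\mu(X)\le\mu(Y)$ whenever $X\subseteq Y\subseteq V(G)$. For $X\subseteq V(G)$, $d(X)$ is the number of edges of the undirected graph $G$ between $X$ and $V(G)\setminus X$. A set $C\subseteq V(G)$ is a $(\mu,p,q)$-cluster if $\mu(C)\le p$ and $d(C)\le q$. A $(\mu,p,q)$-partition of $G$ is a partition of $V(G)$ into $(\mu,p,q)$-clusters. The $(\mu,p,q)$-Partition problem: given a graph $G$ and integers $p,q$, find a $(\mu,p,q)$-partition of $G$ (or report that none exists). *)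

theory Defs
  imports Complex_Main "HOL-Library.Landau_Symbols" "HOL-Library.Disjoint_Sets"
begin

section \<open>Graphs, clusters and partitions\<close>

text \<open>A graph \<open>(n, E)\<close> has vertex set \<open>{0, ..., n - 1}\<close>; edges are two-element vertex sets.\<close>

type_synonym graph = "nat \<times> nat set set"

definition verts :: "graph \<Rightarrow> nat set" where
  "verts G = {..<fst G}"

definition edges :: "graph \<Rightarrow> nat set set" where
  "edges G = snd G"

definition num_verts :: "graph \<Rightarrow> nat" where
  "num_verts G = card (verts G)"

definition num_edges :: "graph \<Rightarrow> nat" where
  "num_edges G = card (edges G)"

definition simple_graph :: "graph \<Rightarrow> bool" where
  "simple_graph G \<longleftrightarrow> (\<forall>e\<in>edges G. \<exists>u\<in>verts G. \<exists>v\<in>verts G. u \<noteq> v \<and> e = {u, v})"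

definition cut_degree :: "graph \<Rightarrow> nat set \<Rightarrow> nat" where
  "cut_degree G X = card {e \<in> edges G. \<exists>u\<in>X. \<exists>v\<in>verts G - X. e = {u, v}}"

definition monotone_measure :: "(graph \<Rightarrow> nat set \<Rightarrow> nat) \<Rightarrow> bool" where
  "monotone_measure \<mu> \<longleftrightarrow>
     (\<forall>G X Y. simple_graph G \<longrightarrow> X \<subseteq> Y \<longrightarrow> Y \<subseteq> verts G \<longrightarrow> \<mu> G X \<le> \<mu> G Y)"

definition is_cluster :: "(graph \<Rightarrow> nat set \<Rightarrow> nat) \<Rightarrow> int \<Rightarrow> int \<Rightarrow> graph \<Rightarrow> nat set \<Rightarrow> bool" where
  "is_cluster \<mu> p q G C \<longleftrightarrow> C \<subseteq> verts G \<and> int (\<mu> G C) \<le> p \<and> int (cut_degree G C) \<le> q"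

definition is_cluster_partition ::
    "(graph \<Rightarrow> nat set \<Rightarrow> nat) \<Rightarrow> int \<Rightarrow> int \<Rightarrow> graph \<Rightarrow> nat set set \<Rightarrow> bool" where
  "is_cluster_partition \<mu> p q G P \<longleftrightarrow> partition_on (verts G) P \<and> (\<forall>C\<in>P. is_cluster \<mu> p q G C)"


section \<open>A unit-cost random access machine\<close>

text \<open>
  Algorithms are while-programs over random access memory. The memory consists of arrays named by
  natural numbers (a program mentions only finitely many of them), each indexed by the integers
  and holding integers. Indices are computed, so addressing is indirect. Every elementary
  operation costs one unit. Multiplication is deliberately not an elementary operation: with
  addition and subtraction only, unit-cost running time is polynomially related to Turing machine
  running time.
\<close>

type_synonym memory = "nat \<Rightarrow> int \<Rightarrow> int"

datatype expr = Const int | Cell nat expr | Plus expr expr | Minus expr expr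

datatype prog =
    Skip
  | Store nat expr expr
  | Seq prog prog
  | IfPos expr prog prog
  | WhilePos expr prog

fun eval_expr :: "expr \<Rightarrow> memory \<Rightarrow> int" where
  "eval_expr (Const k) M = k"
| "eval_expr (Cell a e) M = M a (eval_expr e M)"
| "eval_expr (Plus e f) M = eval_expr e M + eval_expr f M"
| "eval_expr (Minus e f) M = eval_expr e M - eval_expr f M"

fun expr_cost :: "expr \<Rightarrow> nat" where
  "expr_cost (Const k) = 1"
| "expr_cost (Cell a e) = 1 + expr_cost e"
| "expr_cost (Plus e f) = 1 + expr_cost e + expr_cost f"
| "expr_cost (Minus e f) = 1 + expr_cost e + expr_cost f"

text \<open>
  \<open>runs c M t M'\<close>: started in memory \<open>M\<close>, the program \<open>c\<close> halts after exactly \<open>t\<close> time units with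
  memory \<open>M'\<close>. \<open>Store a i e\<close> is the assignment \<open>a[i] := e\<close>; tests ask whether an expression is
  positive.
\<close>

inductive runs :: "prog \<Rightarrow> memory \<Rightarrow> nat \<Rightarrow> memory \<Rightarrow> bool" where
  Skip: "runs Skip M 1 M"
| Store: "runs (Store a i e) M (1 + expr_cost i + expr_cost e)
            (M(a := (M a)(eval_expr i M := eval_expr e M)))"
| Seq: "runs c M t M' \<Longrightarrow> runs d M' u M'' \<Longrightarrow> runs (Seq c d) M (t + u) M''"
| IfTrue: "eval_expr b M > 0 \<Longrightarrow> runs c M t M' \<Longrightarrow> runs (IfPos b c d) M (1 + expr_cost b + t) M'"
| IfFalse: "eval_expr b M \<le> 0 \<Longrightarrow> runs d M t M' \<Longrightarrow> runs (IfPos b c d) M (1 + expr_cost b + t) M'"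
| WhileTrue: "eval_expr b M > 0 \<Longrightarrow> runs c M t M' \<Longrightarrow> runs (WhilePos b c) M' u M''
    \<Longrightarrow> runs (WhilePos b c) M (1 + expr_cost b + t + u) M''"
| WhileFalse: "eval_expr b M \<le> 0 \<Longrightarrow> runs (WhilePos b c) M (1 + expr_cost b) M"

inductive_cases runs_SkipE: "runs Skip M t M'"
inductive_cases runs_StoreE: "runs (Store a i e) M t M'"
inductive_cases runs_SeqE: "runs (Seq c d) M t M'"
inductive_cases runs_IfE: "runs (IfPos b c d) M t M'"
inductive_cases runs_WhileE: "runs (WhilePos b c) M t M'"

lemma runs_deterministic:
  "runs c M t M' \<Longrightarrow> runs c M u M'' \<Longrightarrow> t = u \<and> M' = M''"
proof (induction arbitrary: u M'' rule: runs.induct)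
  case (Skip M)
  then show ?case by (auto elim: runs_SkipE)
next
  case (Store a i e M)
  then show ?case by (auto elim: runs_StoreE)
next
  case (Seq c M t M' d u' M1)
  from Seq.prems obtain t1 M2 u1 where
    "runs c M t1 M2" "runs d M2 u1 M''" "u = t1 + u1"
    by (rule runs_SeqE)
  then show ?case using Seq.IH(1)[of t1 M2] Seq.IH(2)[of u1 M''] by simp
next
  case (IfTrue b M c t M' d)
  from IfTrue.prems IfTrue.hyps(1) obtain t1 where
    "runs c M t1 M''" "u = 1 + expr_cost b + t1"
    by (cases rule: runs_IfE) auto
  then show ?case using IfTrue.IH[of t1 M''] by simp
next
  case (IfFalse b M d t M' c)
  from IfFalse.prems IfFalse.hyps(1) obtain t1 where
    "runs d M t1 M''" "u = 1 + expr_cost b + t1"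
    by (cases rule: runs_IfE) auto
  then show ?case using IfFalse.IH[of t1 M''] by simp
next
  case (WhileTrue b M c t M' u' M1)
  from WhileTrue.prems WhileTrue.hyps(1) obtain t1 M2 u1 where
    "runs c M t1 M2" "runs (WhilePos b c) M2 u1 M''" "u = 1 + expr_cost b + t1 + u1"
    by (cases rule: runs_WhileE) auto
  then show ?case using WhileTrue.IH(1)[of t1 M2] WhileTrue.IH(2)[of u1 M''] by simp
next
  case (WhileFalse b M c)
  from WhileFalse.prems WhileFalse.hyps(1) show ?case
    by (cases rule: runs_WhileE) auto
qed

text \<open>Array number \<open>a\<close> initially holds the \<open>a\<close>-th list; all other cells are zero.\<close>

definition load :: "int list list \<Rightarrow> memory" where
  "load xss = (\<lambda>a i. if a < length xss \<and> 0 \<le> i \<and> i < int (length (xss ! a))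
                      then xss ! a ! nat i else 0)"


section \<open>Algorithms on graphs\<close>

text \<open>
  A graph is presented to a program by \<open>n\<close>, \<open>m\<close> and an edge list, which contains every edge once,
  in an arbitrary order and orientation. Algorithms have to work for every such presentation.
\<close>

definition edge_list_of :: "graph \<Rightarrow> (nat \<times> nat) list \<Rightarrow> bool" where
  "edge_list_of G es \<longleftrightarrow>
     distinct (map (\<lambda>(u, v). {u, v}) es) \<and> set (map (\<lambda>(u, v). {u, v}) es) = edges G"

definition encode_graph :: "graph \<Rightarrow> (nat \<times> nat) list \<Rightarrow> int list list" where
  "encode_graph G es =
     [[int (num_verts G), int (num_edges G)], map (int \<circ> fst) es, map (int \<circ> snd) es]"

definition encode_subset :: "graph \<Rightarrow> nat set \<Rightarrow> int list" where
  "encode_subset G X = map (\<lambda>v. if v \<in> X then 1 else 0) [0..<num_verts G]"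

text \<open>The value of \<open>\<mu>\<close> is returned in cell 0 of array 0.\<close>

definition poly_time_computable :: "(graph \<Rightarrow> nat set \<Rightarrow> nat) \<Rightarrow> bool" where
  "poly_time_computable \<mu> \<longleftrightarrow>
     (\<exists>c K k. \<forall>G es X. simple_graph G \<longrightarrow> edge_list_of G es \<longrightarrow> X \<subseteq> verts G \<longrightarrow>
        (\<exists>t M. runs c (load (encode_graph G es @ [encode_subset G X])) t M \<and>
               M 0 0 = int (\<mu> G X) \<and>
               t \<le> K * (num_verts G + num_edges G + 1) ^ k))"

text \<open>
  Answers to the partition problem: cell 0 of array 0 tells whether a partition exists; if so,
  array 1 holds a class label for each vertex, and the classes are the sets of equally labelled
  vertices.
\<close>

definition label_classes :: "graph \<Rightarrow> (int \<Rightarrow> int) \<Rightarrow> nat set set" where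
  "label_classes G L = (\<lambda>v. {w \<in> verts G. L (int w) = L (int v)}) ` verts G"

definition correct_answer ::
    "(graph \<Rightarrow> nat set \<Rightarrow> nat) \<Rightarrow> int \<Rightarrow> int \<Rightarrow> graph \<Rightarrow> memory \<Rightarrow> bool" where
  "correct_answer \<mu> p q G M \<longleftrightarrow>
     (if \<exists>P. is_cluster_partition \<mu> p q G P
      then M 0 0 = 1 \<and> is_cluster_partition \<mu> p q G (label_classes G (M 1))
      else M 0 0 = 0)"

definition solves_partition_problem ::
    "(graph \<Rightarrow> nat set \<Rightarrow> nat) \<Rightarrow> int \<Rightarrow> (nat \<Rightarrow> nat \<Rightarrow> nat) \<Rightarrow> prog \<Rightarrow> bool" where
  "solves_partition_problem \<mu> q T c \<longleftrightarrow>
     (\<forall>G es p. simple_graph G \<longrightarrow> edge_list_of G es \<longrightarrow>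
        (\<exists>t M. runs c (load (encode_graph G es @ [[p]])) t M \<and>
               correct_answer \<mu> p q G M \<and>
               t \<le> T (num_verts G) (num_edges G)))"

end

theory Submission imports Defs begin

text \<open>
  If every vertex lies in some cluster, a partition exists: two crossing clusters \<open>X\<close>, \<open>Y\<close> satisfy
  \<open>d(X - Y) + d(Y - X) \<le> d(X) + d(Y)\<close>, so one of them can be replaced by its difference with the
  other without increasing its cut, and \<open>\<mu>\<close> is monotone. A cluster \<open>T\<close> containing \<open>v\<close> can be
  replaced by the connected component of \<open>v\<close> after the at most \<open>q\<close> cut edges of \<open>T\<close> are removed,
  so it suffices to try all choices of \<open>q\<close> edges for every \<open>v\<close>. Each time an uncovered vertex gets
  a cluster in this way, the cluster is uncrossed with the classes found so far and becomes a new
  class. Since \<open>m \<le> n\<^sup>2\<close>, trying all choices takes \<open>n\<close> to the power \<open>O(q)\<close> steps.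
\<close>

section \<open>Uncrossing clusters\<close>

text \<open>No choice is ever revised: uncrossing takes only labelled vertices away from a new
  cluster, so the uncovered vertex that asked for it stays inside, and relabelling never uncovers a
  vertex. Passing from a cluster \<open>T\<close> to a component is harmless for two separate
  reasons: the component lies inside \<open>T\<close>, which bounds \<open>\<mu>\<close>, and only
  removed edges leave it, which bounds its cut by \<open>q\<close>. So \<open>\<mu>\<close> is all
  that must be tested for a candidate. The machine has no procedure calls, yet the program for
  \<open>\<mu>\<close> must start from a fresh memory in every trial. It is therefore rewritten to
  record its writes, and undoing them takes time linear in their number. Exponent: let
  \<open>s = n + m + 2\<close> and let \<open>k\<close> be the exponent of the program for
  \<open>\<mu>\<close>. A visit costs a constant times \<open>s ^ (k + 2)\<close>, the
  \<open>q\<close> edge loops and the vertex loop contribute \<open>q + 1\<close>, and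
  \<open>s \<le> 4 * max 1 n ^ 2\<close> doubles the sum to \<open>2 * (k + 3 + q)\<close>.\<close>

locale listed_graph =
  fixes G :: graph and es :: "(nat \<times> nat) list"
  assumes simple: "simple_graph G" and listed: "edge_list_of G es"
begin

abbreviation n :: nat where "n \<equiv> num_verts G"
abbreviation m :: nat where "m \<equiv> length es"
abbreviation src :: "nat \<Rightarrow> nat" where "src e \<equiv> fst (es ! e)"
abbreviation dst :: "nat \<Rightarrow> nat" where "dst e \<equiv> snd (es ! e)"

lemma verts_eq: "verts G = {..<n}"
  by (simp add: verts_def num_verts_def)

lemma edge_nth: "e < m \<Longrightarrow> {src e, dst e} \<in> edges G"
proof -
  assume "e < m"
  then have "(\<lambda>(u, v). {u, v}) (es ! e) \<in> set (map (\<lambda>(u, v). {u, v}) es)"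
    by (simp del: split_paired_Ex)
  then show ?thesis
    using listed by (simp add: edge_list_of_def case_prod_beta)
qed

lemma endpoints: "e < m \<Longrightarrow> src e < n \<and> dst e < n \<and> src e \<noteq> dst e"
proof -
  assume "e < m"
  then obtain u v where "u \<in> verts G" "v \<in> verts G" "u \<noteq> v" "{src e, dst e} = {u, v}"
    using edge_nth simple unfolding simple_graph_def by blast
  then show ?thesis
    by (auto simp: verts_eq doubleton_eq_iff)
qed

lemma src_less [simp]: "e < m \<Longrightarrow> src e < n"
  and dst_less [simp]: "e < m \<Longrightarrow> dst e < n"
  using endpoints by auto

lemma num_edges_eq: "num_edges G = m"
  using listed distinct_card[of "map (\<lambda>(u, v). {u, v}) es"]
  by (simp add: num_edges_def edge_list_of_def)

lemma edges_le: "m \<le> n * n"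
proof -
  have "distinct es"
    using listed by (simp add: edge_list_of_def distinct_map)
  moreover have "set es \<subseteq> {..<n} \<times> {..<n}"
  proof
    fix x assume "x \<in> set es"
    then obtain e where "e < m" "x = es ! e"
      by (auto simp: in_set_conv_nth)
    then show "x \<in> {..<n} \<times> {..<n}"
      using endpoints[of e] by (simp add: mem_Times_iff)
  qed
  ultimately show ?thesis
    using card_mono[of "{..<n} \<times> {..<n}" "set es"] by (simp add: distinct_card)
qed

section \<open>Cuts counted by edge indices\<close>

definition crossing :: "nat set \<Rightarrow> nat set" where
  "crossing X = {e. e < m \<and> (src e \<in> X \<longleftrightarrow> dst e \<notin> X)}"

lemma finite_crossing [simp]: "finite (crossing X)"
  by (simp add: crossing_def)

lemma crossing_empty [simp]: "crossing {} = {}"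
  by (simp add: crossing_def)

text \<open>The list holds each edge once, so sending an index to its edge is injective. Cuts may
  thus be counted over indices, which is what the program sees.\<close>

lemma cut_degree_eq:
  assumes "X \<subseteq> verts G"
  shows "cut_degree G X = card (crossing X)"
proof -
  let ?f = "\<lambda>e. {src e, dst e}"
  have dist: "distinct (map (\<lambda>(u, v). {u, v}) es)" and
    set: "set (map (\<lambda>(u, v). {u, v}) es) = edges G"
    using listed by (auto simp: edge_list_of_def)
  have "inj_on ?f {..<m}"
    using dist unfolding distinct_conv_nth inj_on_def by (force simp: case_prod_beta)
  then have "inj_on ?f (crossing X)"
    by (rule inj_on_subset) (auto simp: crossing_def)
  moreover have "?f ` crossing X = {e \<in> edges G. \<exists>u\<in>X. \<exists>v\<in>verts G - X. e = {u, v}}" (is "_ = ?R")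
  proof
    show "?f ` crossing X \<subseteq> ?R"
    proof
      fix x assume "x \<in> ?f ` crossing X"
      then obtain e where e: "e < m" "src e \<in> X \<longleftrightarrow> dst e \<notin> X" "x = ?f e"
        by (auto simp: crossing_def)
      then have "x \<in> edges G" "src e \<in> verts G" "dst e \<in> verts G"
        using edge_nth by (auto simp: verts_eq)
      then show "x \<in> ?R"
        using e by (cases "src e \<in> X") (auto simp: insert_commute)
    qed
    show "?R \<subseteq> ?f ` crossing X"
    proof
      fix e assume "e \<in> ?R"
      then obtain u v where uv: "e \<in> edges G" "u \<in> X" "v \<in> verts G - X" "e = {u, v}"
        by auto
      then obtain i where i: "i < m" "e = ?f i"
        unfolding set[symmetric] by (auto simp: in_set_conv_nth case_prod_beta)
      then have "i \<in> crossing X"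
        using uv by (auto simp: crossing_def doubleton_eq_iff)
      with i show "e \<in> ?f ` crossing X" by blast
    qed
  qed
  ultimately show ?thesis
    unfolding cut_degree_def by (simp flip: card_image)
qed

text \<open>An edge leaving \<open>X - Y\<close> ends outside \<open>X\<close> or inside
  \<open>Y\<close>, so it crosses \<open>X\<close> or \<open>Y\<close>. An edge that leaves both
  differences joins \<open>X - Y\<close> to \<open>Y - X\<close> and crosses both sets. So union
  goes into union and intersection into intersection.\<close>

lemma crossing_posimodular:
  "card (crossing (X - Y)) + card (crossing (Y - X)) \<le> card (crossing X) + card (crossing Y)"
proof -
  have "card (crossing (X - Y)) + card (crossing (Y - X)) =
      card (crossing (X - Y) \<union> crossing (Y - X)) + card (crossing (X - Y) \<inter> crossing (Y - X))"
    by (rule card_Un_Int) auto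
  also have "\<dots> \<le> card (crossing X \<union> crossing Y) + card (crossing X \<inter> crossing Y)"
    by (intro add_mono card_mono) (auto simp: crossing_def)
  also have "\<dots> = card (crossing X) + card (crossing Y)"
    by (rule card_Un_Int[symmetric]) auto
  finally show ?thesis .
qed

text \<open>The connected component of \<open>v\<close> after the edges with index in \<open>R\<close> are removed.\<close>

definition component :: "nat set \<Rightarrow> nat \<Rightarrow> nat set" where
  "component R v = \<Inter>{T. v \<in> T \<and> crossing T \<subseteq> R}"

lemma component_self: "v \<in> component R v"
  by (simp add: component_def)

lemma component_least: "v \<in> T \<Longrightarrow> crossing T \<subseteq> R \<Longrightarrow> component R v \<subseteq> T"
  by (auto simp: component_def)

lemma crossing_verts [simp]: "crossing {..<n} = {}"
  by (auto simp: crossing_def)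

lemma component_verts: "v < n \<Longrightarrow> component R v \<subseteq> {..<n}"
  by (rule component_least) auto

text \<open>If exactly one end of an edge lies in the intersection, some member of the family misses
  the other end, so the edge crosses that member and belongs to \<open>R\<close>.\<close>

lemma crossing_component: "crossing (component R v) \<subseteq> R"
  unfolding component_def crossing_def by blast

section \<open>Components by repeated relaxation\<close>

definition relax_edge :: "nat set \<Rightarrow> nat \<Rightarrow> nat set \<Rightarrow> nat set" where
  "relax_edge R e S =
     (if e \<in> R then S else if src e \<in> S then insert (dst e) S
      else if dst e \<in> S then insert (src e) S else S)"

text \<open>The edges act one after another on the same set, so a vertex added early in a round
  already counts for later edges. This mirrors the program, which updates a single array in
  place.\<close>

definition relax_round :: "nat set \<Rightarrow> nat set \<Rightarrow> nat set" where
  "relax_round R S = fold (relax_edge R) [0..<m] S"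

lemma relax_edge_incr: "S \<subseteq> relax_edge R e S"
  by (auto simp: relax_edge_def)

lemma fold_relax_incr: "S \<subseteq> fold (relax_edge R) xs S"
  by (induction xs arbitrary: S) (use relax_edge_incr in force)+

text \<open>Every step only enlarges the set, so a fold that ends where it began cannot have moved
  in between.\<close>

lemma fold_relax_fixed:
  "fold (relax_edge R) xs S = S \<Longrightarrow> e \<in> set xs \<Longrightarrow> relax_edge R e S = S"
proof (induction xs)
  case (Cons x xs)
  then have "relax_edge R x S = S"
    using relax_edge_incr[of S R x] fold_relax_incr[of "relax_edge R x S" R xs] by auto
  with Cons show ?case by auto
qed simp

lemma relax_round_fixed: "relax_round R S = S \<Longrightarrow> crossing S \<subseteq> R"
proof
  fix e assume "relax_round R S = S" "e \<in> crossing S"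
  then have "relax_edge R e S = S" "e < m" "src e \<in> S \<longleftrightarrow> dst e \<notin> S"
    using fold_relax_fixed[of R "[0..<m]" S e] by (auto simp: relax_round_def crossing_def)
  then show "e \<in> R"
    by (auto simp: relax_edge_def split: if_splits)
qed

lemma fold_relax_bounded:
  "set xs \<subseteq> {..<m} \<Longrightarrow> S \<subseteq> T \<Longrightarrow> crossing T \<subseteq> R \<Longrightarrow> fold (relax_edge R) xs S \<subseteq> T"
proof (induction xs arbitrary: S)
  case (Cons x xs)
  have "relax_edge R x S \<subseteq> T"
    using Cons.prems by (auto simp: relax_edge_def crossing_def)
  then show ?case
    using Cons by simp
qed simp

lemma relax_round_bounded: "S \<subseteq> T \<Longrightarrow> crossing T \<subseteq> R \<Longrightarrow> relax_round R S \<subseteq> T"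
  unfolding relax_round_def by (rule fold_relax_bounded) auto

lemma relax_iterate_bounded:
  "v \<in> T \<Longrightarrow> crossing T \<subseteq> R \<Longrightarrow> (relax_round R ^^ k) {v} \<subseteq> T"
  by (induction k) (simp_all add: relax_round_bounded)

lemma relax_iterate_component:
  assumes "v < n"
  shows "(relax_round R ^^ n) {v} = component R v"
proof
  let ?S = "\<lambda>k. (relax_round R ^^ k) {v}"
  have bound: "?S k \<subseteq> {..<n}" for k
    using assms by (intro relax_iterate_bounded) auto
  have incr: "?S k \<subseteq> ?S (Suc k)" for k
    using fold_relax_incr by (simp add: relax_round_def)
  \<comment> \<open>A round that is not yet stable gains at least one vertex, starting from one
    vertex at \<open>k = 0\<close>. At \<open>k = n\<close> the second alternative would need more
    than \<open>n\<close> vertices.\<close>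
  have "v \<in> ?S k \<and> (crossing (?S k) \<subseteq> R \<or> k < card (?S k))" for k
  proof (induction k)
    case (Suc k)
    show ?case
    proof (cases "?S (Suc k) = ?S k")
      case True
      then have "crossing (?S k) \<subseteq> R"
        by (intro relax_round_fixed) simp
      with True Suc show ?thesis by simp
    next
      case False
      then have less: "?S k \<subset> ?S (Suc k)"
        using incr[of k] by blast
      then have "card (?S k) < card (?S (Suc k))"
        using bound[of "Suc k"] by (intro psubset_card_mono) (auto intro: finite_subset)
      \<comment> \<open>Otherwise \<open>?S k\<close> would bound its own next round, and nothing
        could have been added.\<close>
      moreover have "\<not> crossing (?S k) \<subseteq> R"
        using relax_round_bounded[of "?S k" "?S k" R] less by auto
      ultimately show ?thesis
        using Suc less by auto
    qed
  qed auto
  from this[of n] have "v \<in> ?S n" "crossing (?S n) \<subseteq> R"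
    using card_mono[OF _ bound[of n]] by auto
  then show "component R v \<subseteq> ?S n"
    by (rule component_least)
  show "?S n \<subseteq> component R v"
    by (intro relax_iterate_bounded component_self crossing_component)
qed

text \<open>A labelling assigns 0 to the vertices that are not yet covered.\<close>

definition label_class :: "(nat \<Rightarrow> int) \<Rightarrow> int \<Rightarrow> nat set" where
  "label_class L l = {w. w < n \<and> L w = l}"

section \<open>Uncrossing a new cluster with all classes\<close>

text \<open>Classes are named by vertices, with an offset of one because label 0 means uncovered.
  The class gives way to \<open>C\<close> whenever its remainder still has a small cut; otherwise
  \<open>C\<close> gives way. A label in use by no vertex passes the test, as the empty set has no
  cut.\<close>

definition shrink :: "nat \<Rightarrow> (nat \<Rightarrow> int) \<Rightarrow> nat \<Rightarrow> nat set \<Rightarrow> nat set" where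
  "shrink q L i C =
     (if card (crossing (label_class L (int i + 1) - C)) \<le> q then C
      else C - label_class L (int i + 1))"

definition uncross :: "nat \<Rightarrow> (nat \<Rightarrow> int) \<Rightarrow> nat set \<Rightarrow> nat set" where
  "uncross q L C = fold (shrink q L) [0..<n] C"

text \<open>Overwriting labels does both jobs at once: it creates the new class and takes its
  vertices away from the old ones.\<close>

definition merge :: "nat \<Rightarrow> (nat \<Rightarrow> int) \<Rightarrow> nat set \<Rightarrow> nat \<Rightarrow> nat \<Rightarrow> int" where
  "merge q L C v w = (if w \<in> uncross q L C then int v + 1 else L w)"

text \<open>The classes are handled in turn, so the last conjunct must survive later changes of the
  cluster. It does because later steps remove only other classes, which are disjoint from the ones
  already handled. The positivity conjunct says that only covered vertices are lost.\<close>

lemma uncross_invariant: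
  assumes L: "\<And>l. l > 0 \<Longrightarrow> card (crossing (label_class L l)) \<le> q"
    and C: "card (crossing C) \<le> q"
  defines "D k \<equiv> fold (shrink q L) [0..<k] C"
  shows "D k \<subseteq> C \<and> (\<forall>w\<in>C - D k. L w > 0) \<and> card (crossing (D k)) \<le> q \<and>
    (\<forall>i<k. card (crossing (label_class L (int i + 1) - D k)) \<le> q)"
proof (induction k)
  case 0
  then show ?case using C by (simp add: D_def)
next
  case (Suc k)
  let ?X = "label_class L (int k + 1)"
  have step: "D (Suc k) = shrink q L k (D k)"
    by (simp add: D_def)
  show ?case
  proof (cases "card (crossing (?X - D k)) \<le> q")
    case True
    then have "D (Suc k) = D k"
      by (simp add: step shrink_def)
    with Suc True show ?thesis
      by (auto simp: less_Suc_eq)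
  next
    case False
    then have eq: "D (Suc k) = D k - ?X"
      by (simp add: step shrink_def)
    have "card (crossing ?X) \<le> q"
      by (rule L) simp
    \<comment> \<open>The two differences have cuts of total size at most \<open>2 * q\<close>, so
      if one exceeds \<open>q\<close> the other is below it.\<close>
    then have "card (crossing (D (Suc k))) \<le> q"
      using crossing_posimodular[of ?X "D k"] False Suc by (simp add: eq)
    moreover have "label_class L (int i + 1) - D (Suc k) = label_class L (int i + 1) - D k"
      if "i < k" for i
      using that by (auto simp: eq label_class_def)
    moreover have "?X - D (Suc k) = ?X"
      by (auto simp: eq)
    moreover have "\<forall>w\<in>C - D (Suc k). L w > 0"
      using Suc by (auto simp: eq label_class_def)
    ultimately show ?thesis
      using Suc \<open>card (crossing ?X) \<le> q\<close> by (auto simp: less_Suc_eq eq)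
  qed
qed

end

section \<open>The greedy search on labellings\<close>

locale partition_search = listed_graph +
  fixes \<mu> :: "graph \<Rightarrow> nat set \<Rightarrow> nat" and p :: int and q :: nat
  assumes mono: "monotone_measure \<mu>"
begin

abbreviation cluster :: "nat set \<Rightarrow> bool" where
  "cluster \<equiv> is_cluster \<mu> p (int q) G"

lemma cluster_iff:
  "cluster C \<longleftrightarrow> C \<subseteq> {..<n} \<and> int (\<mu> G C) \<le> p \<and> card (crossing C) \<le> q"
  unfolding is_cluster_def using cut_degree_eq[of C] by (auto simp: verts_eq)

lemma measure_mono: "X \<subseteq> Y \<Longrightarrow> Y \<subseteq> {..<n} \<Longrightarrow> \<mu> G X \<le> \<mu> G Y"
  using mono simple unfolding monotone_measure_def verts_eq[symmetric] by blast

text \<open>The last conjunct keeps labels fresh: \<open>v + 1\<close> can occur only if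
  \<open>v\<close> is covered, though perhaps by now in another class. Hence an uncovered
  \<open>v\<close> may use it without colliding with an old class.\<close>

definition valid :: "(nat \<Rightarrow> int) \<Rightarrow> bool" where
  "valid L \<longleftrightarrow>
     (\<forall>w. 0 \<le> L w \<and> L w \<le> int n) \<and> (\<forall>w\<ge>n. L w = 0) \<and>
     (\<forall>w<n. L w > 0 \<longrightarrow> cluster (label_class L (L w))) \<and>
     (\<forall>w v. L w = int v + 1 \<longrightarrow> L v > 0)"

lemma valid_merge:
  assumes L: "valid L" and v: "v < n" "L v \<le> 0" and C: "cluster C" "v \<in> C"
  shows "valid (merge q L C v)" "merge q L C v v > 0" "L w > 0 \<Longrightarrow> merge q L C v w > 0"
proof -
  let ?D = "uncross q L C" and ?L = "merge q L C v"
  have cls: "cluster (label_class L l)" if "l > 0" "label_class L l \<noteq> {}" for l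
    using that L by (auto simp: valid_def label_class_def)
  then have "card (crossing (label_class L l)) \<le> q" if "l > 0" for l
    using that by (cases "label_class L l = {}") (auto simp: cluster_iff)
  from uncross_invariant[OF this, of C n] C
  have D: "?D \<subseteq> C" "\<And>w. w \<in> C - ?D \<Longrightarrow> L w > 0" "card (crossing ?D) \<le> q"
    "\<And>i. i < n \<Longrightarrow> card (crossing (label_class L (int i + 1) - ?D)) \<le> q"
    by (auto simp: uncross_def cluster_iff)
  have "v \<in> ?D"
    using D(2)[of v] C v by auto
  then show pos_v: "?L v > 0"
    by (simp add: merge_def)
  show pos: "L w > 0 \<Longrightarrow> ?L w > 0" for w
    by (simp add: merge_def)
  have D_verts: "?D \<subseteq> {..<n}"
    using D(1) C by (auto simp: cluster_iff)
  have fresh: "L w \<noteq> int v + 1" for w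
    using L v unfolding valid_def by (metis not_less)
  have class_v: "label_class ?L (int v + 1) = ?D"
    using fresh D_verts by (auto simp: label_class_def merge_def)
  have class_old: "label_class ?L l = label_class L l - ?D" if "l \<noteq> int v + 1" for l
    using that by (auto simp: label_class_def merge_def)
  have "cluster ?D"
    using C(1) D(1,3) D_verts measure_mono[OF D(1)] by (auto simp: cluster_iff)
  moreover have "cluster (label_class L (L w) - ?D)" if "w < n" "L w > 0" for w
  proof -
    \<comment> \<open>The vertex that names the class of \<open>w\<close>; it is below
      \<open>n\<close> because labels are at most \<open>n\<close>, so the uncrossing invariant
      covers this class.\<close>
    define i where "i = nat (L w - 1)"
    have i: "i < n" "L w = int i + 1"
      using that L unfolding valid_def i_def by (smt (verit) nat_less_iff int_nat_eq)+
    have "cluster (label_class L (L w))"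
      using that by (intro cls) (auto simp: label_class_def)
    then show ?thesis
      using D(4)[OF i(1)] i(2) measure_mono[of "label_class L (L w) - ?D" "label_class L (L w)"]
      by (auto simp: cluster_iff)
  qed
  ultimately have clusters: "cluster (label_class ?L (?L w))" if "w < n" "?L w > 0" for w
    using that class_v class_old[of "L w"] fresh[of w] by (auto simp: merge_def)
  have "?L w = int u + 1 \<Longrightarrow> ?L u > 0" for w u
    using L pos_v pos[of u] unfolding valid_def by (auto simp: merge_def split: if_splits)
  moreover have "0 \<le> ?L w \<and> ?L w \<le> int n" for w
    using L v by (auto simp: valid_def merge_def)
  moreover have "w \<ge> n \<Longrightarrow> ?L w = 0" for w
    using L D_verts by (auto simp: valid_def merge_def)
  ultimately show "valid ?L"
    using clusters by (auto simp: valid_def)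
qed

text \<open>There is no test of the cut: with at most \<open>q\<close> indices in \<open>R\<close>,
  the component has a cut of at most \<open>q\<close> automatically.\<close>

definition visit :: "nat \<Rightarrow> nat set \<Rightarrow> (nat \<Rightarrow> int) \<Rightarrow> nat \<Rightarrow> int" where
  "visit v R L =
     (if L v \<le> 0 \<and> int (\<mu> G (component R v)) \<le> p then merge q L (component R v) v else L)"

lemma visit_valid:
  assumes "valid L" "v < n" "finite R" "card R \<le> q"
  shows "valid (visit v R L)" "L w > 0 \<Longrightarrow> visit v R L w > 0"
proof -
  have "card (crossing (component R v)) \<le> q"
    using card_mono[OF assms(3) crossing_component[of R v]] assms(4) by simp
  then have "cluster (component R v)" if "int (\<mu> G (component R v)) \<le> p"
    using that component_verts assms(2) by (auto simp: cluster_iff)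
  then show "valid (visit v R L)" "L w > 0 \<Longrightarrow> visit v R L w > 0"
    using assms(1,2) valid_merge[of L v "component R v"] component_self[of v R]
    by (auto simp: visit_def)
qed

text \<open>\<open>component R v\<close> is the least set around \<open>v\<close> that only edges in
  \<open>R\<close> leave, so it lies in \<open>T\<close> and inherits the bound on
  \<open>\<mu>\<close>. The unknown cluster \<open>T\<close> itself never has to be found.\<close>

lemma visit_covers:
  assumes "valid L" "v < n" "finite R" "card R \<le> q" "cluster T" "v \<in> T" "crossing T \<subseteq> R"
  shows "visit v R L v > 0"
proof (cases "L v > 0")
  case False
  have sub: "component R v \<subseteq> T"
    using assms by (intro component_least)
  then have mu: "int (\<mu> G (component R v)) \<le> p"
    using measure_mono[OF sub] assms by (auto simp: cluster_iff)
  have "card (crossing (component R v)) \<le> q"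
    using card_mono[OF assms(3) crossing_component[of R v]] assms(4) by simp
  then have "cluster (component R v)"
    using mu component_verts assms(2) by (auto simp: cluster_iff)
  then show ?thesis
    using False mu valid_merge(2)[of L v "component R v"] assms component_self[of v R]
    by (auto simp: visit_def)
qed (use visit_valid assms in auto)

text \<open>\<open>r\<close> counts how often an edge index has been removed; index \<open>m\<close> stands for no removal.\<close>

primrec search :: "nat \<Rightarrow> nat \<Rightarrow> (nat \<Rightarrow> int) \<Rightarrow> (nat \<Rightarrow> int) \<Rightarrow> nat \<Rightarrow> int" where
  "search v 0 r L = visit v {e. r e > 0} L"
| "search v (Suc j) r L = fold (\<lambda>x. search v j (r(x := r x + 1))) [0..<Suc m] L"

text \<open>Each of the \<open>j\<close> loops still to be entered adds at most one new index, so at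
  the innermost level at most \<open>q\<close> indices are removed.\<close>

definition budget :: "nat \<Rightarrow> (nat \<Rightarrow> int) \<Rightarrow> bool" where
  "budget j r \<longleftrightarrow> (\<forall>e. r e \<ge> 0) \<and> finite {e. r e > 0} \<and> card {e. r e > 0} + j \<le> q"

lemma removed_insert: "(\<And>e. r e \<ge> 0) \<Longrightarrow> {e. (r(x := r x + 1)) e > (0::int)} = insert x {e. r e > 0}"
  by (auto intro: le_imp_0_less simp: add.commute)

lemma budget_step:
  assumes "budget (Suc j) r"
  shows "budget j (r(x := r x + 1))"
proof -
  have "{e. (r(x := r x + 1)) e > 0} = insert x {e. r e > 0}"
    using assms by (intro removed_insert) (auto simp: budget_def)
  moreover have "(r(x := r x + 1)) e \<ge> 0" for e
    using assms by (auto simp: budget_def add_increasing2)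
  ultimately show ?thesis
    using assms unfolding budget_def by (simp add: card_insert_if)
qed

lemma fold_valid:
  assumes "\<And>x L. valid L \<Longrightarrow> valid (f x L) \<and> (\<forall>w. L w > 0 \<longrightarrow> f x L w > 0)" "valid L"
  shows "valid (fold f xs L) \<and> (\<forall>w. L w > 0 \<longrightarrow> fold f xs L w > 0)"
  using assms(2) by (induction xs arbitrary: L) (use assms(1) in auto)

lemma search_valid:
  assumes "valid L" "v < n" "budget j r"
  shows "valid (search v j r L) \<and> (\<forall>w. L w > 0 \<longrightarrow> search v j r L w > 0)"
  using assms
proof (induction j arbitrary: r L)
  case 0
  then show ?case using visit_valid[of L v "{e. r e > 0}"] by (auto simp: budget_def)
next
  case (Suc j)
  show ?case
    unfolding search.simps
  proof (rule fold_valid)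
    fix x L assume "valid L"
    then show "valid (search v j (r(x := r x + 1)) L) \<and>
        (\<forall>w. L w > 0 \<longrightarrow> search v j (r(x := r x + 1)) L w > 0)"
      by (rule Suc.IH[OF _ Suc.prems(2) budget_step[OF Suc.prems(3), of x]])
  qed (rule Suc.prems)
qed

text \<open>\<open>xs\<close> lists the right choices for the remaining loops, outermost first.
  Earlier iterations may have changed the labelling, but they keep it valid, which is all that the
  right iteration needs; later iterations keep \<open>v\<close> covered.\<close>

lemma search_covers:
  assumes "valid L" "v < n" "budget j r" "cluster T" "v \<in> T"
    "length xs = j" "crossing T \<subseteq> {e. r e > 0} \<union> set xs" "set xs \<subseteq> {..m}"
  shows "search v j r L v > 0"
  using assms
proof (induction j arbitrary: r L xs)
  case 0
  then show ?case using visit_covers[of L v "{e. r e > 0}"] by (auto simp: budget_def)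
next
  case (Suc j)
  from Suc.prems(6) obtain x ys where xs: "xs = x # ys" "length ys = j"
    by (cases xs) auto
  define f where "f x = search v j (r(x := r x + 1))" for x
  have valid_f: "valid L \<Longrightarrow> valid (f x L) \<and> (\<forall>w. L w > 0 \<longrightarrow> f x L w > 0)" for x L
    unfolding f_def by (rule search_valid[OF _ Suc.prems(2) budget_step[OF Suc.prems(3), of x]])
  note valid_fold = fold_valid[of f, OF valid_f]
  \<comment> \<open>The loop is cut at the iteration that makes the right choice
    \<open>x\<close>.\<close>
  have split: "[0..<Suc m] = [0..<x] @ x # [Suc x..<Suc m]"
    using Suc.prems(8) xs upt_add_eq_append[of 0 x "Suc m - x"] by (auto simp: upt_conv_Cons)
  have "{e. (r(x := r x + 1)) e > 0} = insert x {e. r e > 0}"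
    using Suc.prems(3) by (intro removed_insert) (auto simp: budget_def)
  then have "crossing T \<subseteq> {e. (r(x := r x + 1)) e > 0} \<union> set ys"
    using Suc.prems(7) xs by auto
  moreover have valid_x: "valid (fold f [0..<x] L)"
    using valid_fold Suc.prems(1) by blast
  ultimately have "f x (fold f [0..<x] L) v > 0"
    unfolding f_def
    using Suc.prems xs by (intro Suc.IH[of _ _ ys] budget_step[OF Suc.prems(3), of x]) auto
  then have "fold f [Suc x..<Suc m] (f x (fold f [0..<x] L)) v > 0"
    using valid_fold valid_f valid_x by blast
  then show ?case
    unfolding search.simps split f_def by (simp only: fold_append fold_Cons comp_def)
qed

definition labelling :: "nat \<Rightarrow> int" where
  "labelling = fold (\<lambda>v. search v q (\<lambda>_. 0)) [0..<n] (\<lambda>_. 0)"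

text \<open>The nest consists of exactly \<open>q\<close> loops, so a smaller cut is padded with the
  dummy index \<open>m\<close>.\<close>

lemma search_list:
  assumes "finite A" "card A \<le> q" "A \<subseteq> {..<m}"
  obtains xs where "length xs = q" "A \<subseteq> set xs" "set xs \<subseteq> {..m}"
proof -
  obtain ys where ys: "set ys = A" "distinct ys"
    using finite_distinct_list[OF assms(1)] by blast
  show thesis
    using assms ys distinct_card[of ys]
    by (intro that[of "ys @ replicate (q - card A) m"]) auto
qed

lemma labelling_fold:
  assumes "k \<le> n"
  shows "valid (fold (\<lambda>v. search v q (\<lambda>_. 0)) [0..<k] (\<lambda>_. 0)) \<and>
    (\<forall>v<k. (\<exists>T. cluster T \<and> v \<in> T) \<longrightarrow> fold (\<lambda>v. search v q (\<lambda>_. 0)) [0..<k] (\<lambda>_. 0) v > 0)"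
  using assms
proof (induction k)
  case 0
  then show ?case by (simp add: valid_def)
next
  case (Suc k)
  let ?L = "fold (\<lambda>v. search v q (\<lambda>_. 0)) [0..<k] (\<lambda>_. 0)"
  have L: "valid ?L" "\<And>v. v < k \<Longrightarrow> (\<exists>T. cluster T \<and> v \<in> T) \<Longrightarrow> ?L v > 0"
    using Suc by auto
  have b: "budget q (\<lambda>_. 0)"
    by (simp add: budget_def)
  have new: "search k q (\<lambda>_. 0) ?L k > 0" if T: "cluster T" "k \<in> T" for T
  proof -
    obtain xs where "length xs = q" "crossing T \<subseteq> set xs" "set xs \<subseteq> {..m}"
      using T(1) by (elim search_list[of "crossing T", rotated 3]) (auto simp: cluster_iff crossing_def)
    then show ?thesis
      using T Suc.prems L b by (intro search_covers[of _ _ _ _ T xs]) auto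
  qed
  show ?case
    using search_valid[OF L(1) _ b, of k] new L(2) Suc.prems
    by (auto simp: less_Suc_eq)
qed

lemma valid_labelling: "valid labelling"
  using labelling_fold[of n] by (simp add: labelling_def)

text \<open>Together with \<open>covered_partition\<close> this makes full coverage equivalent to
  the existence of a partition: the part containing \<open>v\<close> is the cluster that the search
  is guaranteed to exploit.\<close>

lemma partition_covered:
  assumes "is_cluster_partition \<mu> p (int q) G P" "v < n"
  shows "labelling v > 0"
proof -
  have "\<exists>T. cluster T \<and> v \<in> T"
    using assms unfolding is_cluster_partition_def partition_on_def verts_eq by blast
  then show ?thesis
    using labelling_fold[of n] assms(2) by (simp add: labelling_def)
qed

lemma covered_partition:
  assumes "\<And>v. v < n \<Longrightarrow> labelling v > 0" "\<And>v. v < n \<Longrightarrow> L (int v) = labelling v"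
  shows "is_cluster_partition \<mu> p (int q) G (label_classes G L)"
proof -
  have eq: "label_classes G L = (\<lambda>v. label_class labelling (labelling v)) ` {..<n}"
    using assms(2) by (auto simp: label_classes_def verts_eq label_class_def intro!: image_cong)
  have "partition_on {..<n} (label_classes G L)"
    unfolding eq by (rule partition_onI) (auto simp: label_class_def disjnt_def)
  moreover have "cluster (label_class labelling (labelling v))" if "v < n" for v
    using that assms(1) valid_labelling by (auto simp: valid_def)
  ultimately show ?thesis
    by (auto simp: is_cluster_partition_def verts_eq eq)
qed

end


section \<open>Reasoning about programs\<close>

text \<open>Total correctness with an upper bound on the time. Unlike the exact time in
  \<open>runs\<close>, such a bound does not depend on the branches taken, so bounds
  compose.\<close>

definition exec :: "prog \<Rightarrow> memory \<Rightarrow> nat \<Rightarrow> (memory \<Rightarrow> bool) \<Rightarrow> bool" where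
  "exec c M T Q \<longleftrightarrow> (\<exists>t M'. runs c M t M' \<and> t \<le> T \<and> Q M')"

lemma execI: "runs c M t M' \<Longrightarrow> t \<le> T \<Longrightarrow> Q M' \<Longrightarrow> exec c M T Q"
  by (auto simp: exec_def)

lemma exec_mono:
  "exec c M T Q \<Longrightarrow> T \<le> T' \<Longrightarrow> (\<And>M'. Q M' \<Longrightarrow> Q' M') \<Longrightarrow> exec c M T' Q'"
  by (auto simp: exec_def intro: order_trans)

lemma exec_Seq:
  assumes "exec c M T1 R" "\<And>M'. R M' \<Longrightarrow> exec d M' T2 Q" "T1 + T2 \<le> T"
  shows "exec (Seq c d) M T Q"
proof -
  obtain t M' where 1: "runs c M t M'" "t \<le> T1" "R M'"
    using assms(1) by (auto simp: exec_def)
  obtain u M'' where 2: "runs d M' u M''" "u \<le> T2" "Q M''"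
    using assms(2)[OF 1(3)] by (auto simp: exec_def)
  show ?thesis
    using 1 2 assms(3) by (intro execI[OF runs.Seq[OF 1(1) 2(1)]]) auto
qed

lemma exec_IfPos:
  assumes "eval_expr b M > 0 \<Longrightarrow> exec c M T' Q" "eval_expr b M \<le> 0 \<Longrightarrow> exec d M T' Q"
    "1 + expr_cost b + T' \<le> T"
  shows "exec (IfPos b c d) M T Q"
proof (cases "eval_expr b M > 0")
  case True
  then obtain t M' where "runs c M t M'" "t \<le> T'" "Q M'"
    using assms(1) by (auto simp: exec_def)
  then show ?thesis
    using True assms(3) by (intro execI[OF runs.IfTrue[of b M c t M']]) auto
next
  case False
  then obtain t M' where "runs d M t M'" "t \<le> T'" "Q M'"
    using assms(2) by (auto simp: exec_def)
  then show ?thesis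
    using False assms(3) by (intro execI[OF runs.IfFalse[of b M d t M']]) auto
qed

section \<open>Loop-free code by symbolic evaluation\<close>

text \<open>Without loops the final memory is a function of the initial one, and correctness becomes
  simplification. The values of \<open>result\<close> and \<open>max_cost\<close> at
  \<open>WhilePos\<close> are placeholders excluded by \<open>loop_free\<close>.\<close>

primrec loop_free :: "prog \<Rightarrow> bool" where
  "loop_free Skip \<longleftrightarrow> True"
| "loop_free (Store a i e) \<longleftrightarrow> True"
| "loop_free (Seq c d) \<longleftrightarrow> loop_free c \<and> loop_free d"
| "loop_free (IfPos b c d) \<longleftrightarrow> loop_free c \<and> loop_free d"
| "loop_free (WhilePos b c) \<longleftrightarrow> False"

primrec result :: "prog \<Rightarrow> memory \<Rightarrow> memory" where
  "result Skip M = M"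
| "result (Store a i e) M = M(a := (M a)(eval_expr i M := eval_expr e M))"
| "result (Seq c d) M = result d (result c M)"
| "result (IfPos b c d) M = (if eval_expr b M > 0 then result c M else result d M)"
| "result (WhilePos b c) M = M"

primrec max_cost :: "prog \<Rightarrow> nat" where
  "max_cost Skip = 1"
| "max_cost (Store a i e) = 1 + expr_cost i + expr_cost e"
| "max_cost (Seq c d) = max_cost c + max_cost d"
| "max_cost (IfPos b c d) = 1 + expr_cost b + max (max_cost c) (max_cost d)"
| "max_cost (WhilePos b c) = 0"

lemma exec_loop_free:
  "loop_free c \<Longrightarrow> Q (result c M) \<Longrightarrow> max_cost c \<le> T \<Longrightarrow> exec c M T Q"
proof (induction c arbitrary: M T Q)
  case Skip
  then show ?case by (auto intro: execI runs.Skip)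
next
  case (Store a i e)
  then show ?case by (intro execI[OF runs.Store]) simp_all
next
  case (Seq c d)
  then show ?case
    by (intro exec_Seq[of c M "max_cost c" "\<lambda>M'. M' = result c M" d "max_cost d"]) auto
next
  case (IfPos b c d)
  then show ?case
    by (intro exec_IfPos[of _ _ _ "max (max_cost c) (max_cost d)"]) auto
qed auto

section \<open>Counting loops and their cost\<close>

definition For :: "nat \<Rightarrow> int \<Rightarrow> expr \<Rightarrow> prog \<Rightarrow> prog" where
  "For a k b c =
     Seq (Store a (Const k) (Const 0))
       (WhilePos (Minus b (Cell a (Const k)))
         (Seq c (Store a (Const k) (Plus (Cell a (Const k)) (Const 1)))))"

text \<open>The invariant speaks of the memory after the counter has been incremented. A test costs
  at most 8 and the increment 6, hence 14 per iteration; the initial store (3) and the last test (8)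
  are paid by the extra summand in \<open>Suc N\<close>.\<close>

lemma exec_For:
  assumes start: "I 0 (M(a := (M a)(k := 0)))"
    and counter: "\<And>i M. I i M \<Longrightarrow> M a k = int i \<and> eval_expr b M = int N"
    and body: "\<And>i M. i < N \<Longrightarrow> I i M \<Longrightarrow>
      exec c M T (\<lambda>M'. I (Suc i) (M'(a := (M' a)(k := M' a k + 1))))"
    and post: "\<And>M. I N M \<Longrightarrow> Q M"
    and cost: "expr_cost b \<le> 4" "Suc N * (T + 14) \<le> T'"
  shows "exec (For a k b c) M T' Q"
proof -
  let ?w = "WhilePos (Minus b (Cell a (Const k)))
         (Seq c (Store a (Const k) (Plus (Cell a (Const k)) (Const 1))))"
  have loop: "exec ?w M (j * (T + 14) + 8) Q" if "I i M" "j + i = N" for i j M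
    using that
  proof (induction j arbitrary: i M)
    case 0
    then have "runs ?w M (1 + expr_cost (Minus b (Cell a (Const k)))) M"
      using counter[OF 0(1)] by (intro runs.WhileFalse) simp
    then show ?case
      using 0 post cost(1) by (intro execI) auto
  next
    case (Suc j)
    then obtain t M' where t: "runs c M t M'" "t \<le> T" "I (Suc i) (M'(a := (M' a)(k := M' a k + 1)))"
      using body[OF _ Suc.prems(1)] by (auto simp: exec_def)
    let ?M = "M'(a := (M' a)(k := M' a k + 1))"
    obtain u M'' where u: "runs ?w ?M u M''" "u \<le> j * (T + 14) + 8" "Q M''"
      using Suc.IH[OF t(3)] Suc.prems by (auto simp: exec_def simp del: fun_upd_apply)
    have "runs (Store a (Const k) (Plus (Cell a (Const k)) (Const 1))) M' 6 ?M"
      using runs.Store[of a "Const k" "Plus (Cell a (Const k)) (Const 1)" M']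
      by (simp add: eval_nat_numeral)
    then have "runs (Seq c (Store a (Const k) (Plus (Cell a (Const k)) (Const 1)))) M (t + 6) ?M"
      using t by (intro runs.Seq)
    then have "runs ?w M (1 + expr_cost (Minus b (Cell a (Const k))) + (t + 6) + u) M''"
      using u counter[OF Suc.prems(1)] Suc.prems(2) by (intro runs.WhileTrue) auto
    then show ?case
      using t(2) u(2,3) cost(1) by (intro execI) auto
  qed
  show ?thesis
    unfolding For_def
    by (rule exec_Seq[of _ _ 3 "\<lambda>M'. M' = M(a := (M a)(k := 0))", OF exec_loop_free])
       (use loop[OF start] cost(2) in auto)
qed

text \<open>Bounds in the normal form \<open>A * s ^ d\<close>: every loop raises the exponent by
  one and the factor by 14. A body of cost at most 40 gives the recurring bound
  \<open>54 * s\<close>.\<close>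

lemma exec_For_power:
  assumes "I 0 (M(a := (M a)(k := 0)))"
    and "\<And>i M. I i M \<Longrightarrow> M a k = int i \<and> eval_expr b M = int N"
    and "\<And>i M. i < N \<Longrightarrow> I i M \<Longrightarrow>
      exec c M (A * s ^ d) (\<lambda>M'. I (Suc i) (M'(a := (M' a)(k := M' a k + 1))))"
    and "\<And>M. I N M \<Longrightarrow> Q M"
    and "expr_cost b \<le> 4" and N: "Suc N \<le> s" and T: "(A + 14) * s ^ Suc d \<le> T"
  shows "exec (For a k b c) M T Q"
proof (rule exec_For[of I, OF assms(1-5)])
  have "1 \<le> s ^ d"
    using N by (cases s) auto
  then have "A * s ^ d + 14 \<le> (A + 14) * s ^ d"
    by (simp add: distrib_right)
  then have "Suc N * (A * s ^ d + 14) \<le> s * ((A + 14) * s ^ d)"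
    using N by (intro mult_mono) auto
  then show "Suc N * (A * s ^ d + 14) \<le> T"
    using T by (simp add: mult_ac)
qed

definition same :: "nat set \<Rightarrow> memory \<Rightarrow> memory \<Rightarrow> bool" where
  "same S M' M \<longleftrightarrow> (\<forall>a. a \<notin> S \<longrightarrow> M' a = M a)"

lemma same_refl [simp]: "same S M M"
  by (simp add: same_def)

lemma same_trans: "same S M'' M' \<Longrightarrow> same S M' M \<Longrightarrow> same S M'' M"
  by (simp add: same_def)

lemma same_subset: "same S M' M \<Longrightarrow> S \<subseteq> S' \<Longrightarrow> same S' M' M"
  by (auto simp: same_def)

lemma same_update [simp]: "a \<in> S \<Longrightarrow> same S (M'(a := f)) M \<longleftrightarrow> same S M' M"
  by (auto simp: same_def)


section \<open>Running a program with its writes recorded\<close>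

text \<open>
  The memory of a foreign program is not clean after it has halted, and its addresses are not
  bounded by its running time. So array \<open>a\<close> of the program is moved to array \<open>20 + 2 * a\<close>, and the
  addresses written to are recorded in array \<open>21 + 2 * a\<close>, whose cell 0 holds their number.
\<close>

fun shift_expr :: "expr \<Rightarrow> expr" where
  "shift_expr (Const k) = Const k"
| "shift_expr (Cell a e) = Cell (20 + 2 * a) (shift_expr e)"
| "shift_expr (Plus e f) = Plus (shift_expr e) (shift_expr f)"
| "shift_expr (Minus e f) = Minus (shift_expr e) (shift_expr f)"

definition recorded_store :: "nat \<Rightarrow> expr \<Rightarrow> expr \<Rightarrow> prog" where
  "recorded_store a i e =
     Seq (Store (21 + 2 * a) (Const 0) (Plus (Cell (21 + 2 * a) (Const 0)) (Const 1)))
       (Seq (Store (21 + 2 * a) (Cell (21 + 2 * a) (Const 0)) i) (Store (20 + 2 * a) i e))"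

primrec recorded :: "prog \<Rightarrow> prog" where
  "recorded Skip = Skip"
| "recorded (Store a i e) = recorded_store a (shift_expr i) (shift_expr e)"
| "recorded (Seq c d) = Seq (recorded c) (recorded d)"
| "recorded (IfPos b c d) = IfPos (shift_expr b) (recorded c) (recorded d)"
| "recorded (WhilePos b c) = WhilePos (shift_expr b) (recorded c)"

definition shifted :: "memory \<Rightarrow> memory" where
  "shifted M = (\<lambda>a. M (20 + 2 * a))"

definition writes :: "memory \<Rightarrow> nat \<Rightarrow> int" where
  "writes M a = M (21 + 2 * a) 0"

text \<open>Only nonzero cells have to be listed, possibly several times: zeroing all listed
  addresses then clears the array.\<close>

definition record_complete :: "memory \<Rightarrow> nat \<Rightarrow> bool" where
  "record_complete M a \<longleftrightarrow> 0 \<le> writes M a \<and>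
     (\<forall>i. M (20 + 2 * a) i \<noteq> 0 \<longrightarrow> (\<exists>j. 0 < j \<and> j \<le> writes M a \<and> M (21 + 2 * a) j = i))"

lemma eval_shift [simp]: "eval_expr (shift_expr e) M = eval_expr e (shifted M)"
  by (induction e) (simp_all add: shifted_def)

lemma cost_shift [simp]: "expr_cost (shift_expr e) = expr_cost e"
  by (induction e) simp_all

lemma cost_pos: "0 < expr_cost e"
  by (cases e) simp_all

lemma even_ne_odd [simp]: "20 + 2 * a \<noteq> 21 + 2 * (b::nat)" "21 + 2 * (b::nat) \<noteq> 20 + 2 * a"
  by presburger+

text \<open>The record is written before the store itself, so address and value must not depend on
  the record array. Shifted expressions satisfy this, since they read only even arrays.\<close>

lemma exec_recorded_store:
  assumes i: "\<And>f. eval_expr i (M(21 + 2 * a := f)) = eval_expr i M"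
    and e: "\<And>f. eval_expr e (M(21 + 2 * a := f)) = eval_expr e M"
    and complete: "\<And>b. record_complete M b"
    and T: "10 + 2 * expr_cost i + expr_cost e \<le> T"
  shows "exec (recorded_store a i e) M T
    (\<lambda>M'. shifted M' = (shifted M)(a := (shifted M a)(eval_expr i M := eval_expr e M)) \<and>
      (\<forall>b. record_complete M' b) \<and> same {20 + 2 * a, 21 + 2 * a} M' M \<and>
      (\<forall>b. writes M' b \<le> writes M b + 1))"
proof -
  let ?k = "writes M a + 1"
  let ?M = "M(21 + 2 * a := (M (21 + 2 * a))(0 := ?k, ?k := eval_expr i M),
    20 + 2 * a := (M (20 + 2 * a))(eval_expr i M := eval_expr e M))"
  \<comment> \<open>Keeps the new record slot apart from cell 0, the counter.\<close>
  have k: "?k > 0"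
    using complete[of a] by (simp add: record_complete_def)
  have res: "result (recorded_store a i e) M = ?M"
    using k by (simp add: recorded_store_def i e writes_def fun_upd_twist)
  have w: "writes ?M b = (if b = a then ?k else writes M b)" for b
    using k by (simp add: writes_def)
  have "record_complete ?M b" for b
  proof (cases "b = a")
    case True
    show ?thesis
      unfolding record_complete_def w
    proof (intro conjI allI impI)
      fix l assume l: "?M (20 + 2 * b) l \<noteq> 0"
      show "\<exists>j>0. j \<le> (if b = a then ?k else writes M b) \<and> ?M (21 + 2 * b) j = l"
      proof (cases "l = eval_expr i M")
        case True
        then show ?thesis using k \<open>b = a\<close> by (intro exI[of _ ?k]) simp
      next
        case False
        then obtain j where "0 < j" "j \<le> writes M a" "M (21 + 2 * a) j = l"
          using l \<open>b = a\<close> complete[of a] by (auto simp: record_complete_def)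
        then show ?thesis using \<open>b = a\<close> by (intro exI[of _ j]) auto
      qed
    qed (use k True in simp)
  next
    case False
    then show ?thesis
      using complete[of b] by (simp add: record_complete_def writes_def)
  qed
  moreover have "shifted ?M = (shifted M)(a := (shifted M a)(eval_expr i M := eval_expr e M))"
    by (auto simp: shifted_def fun_eq_iff)
  ultimately show ?thesis
    using T w
    by (intro exec_loop_free) (simp_all only: res, simp_all add: recorded_store_def same_def)
qed

text \<open>Only arrays that are written to count, because only these have to be cleaned.\<close>

primrec arrays_below :: "nat \<Rightarrow> prog \<Rightarrow> bool" where
  "arrays_below N Skip \<longleftrightarrow> True"
| "arrays_below N (Store a i e) \<longleftrightarrow> a < N"
| "arrays_below N (Seq c d) \<longleftrightarrow> arrays_below N c \<and> arrays_below N d"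
| "arrays_below N (IfPos b c d) \<longleftrightarrow> arrays_below N c \<and> arrays_below N d"
| "arrays_below N (WhilePos b c) \<longleftrightarrow> arrays_below N c"

lemma arrays_below_mono: "arrays_below N c \<Longrightarrow> N \<le> N' \<Longrightarrow> arrays_below N' c"
  by (induction c) auto

lemma arrays_below_exists: "\<exists>N. arrays_below N c"
proof (induction c)
  case (Seq c d)
  then obtain N N' where "arrays_below N c" "arrays_below N' d" by blast
  then show ?case by (auto intro!: exI[of _ "max N N'"] elim: arrays_below_mono)
next
  case (IfPos b c d)
  then obtain N N' where "arrays_below N c" "arrays_below N' d" by blast
  then show ?case by (auto intro!: exI[of _ "max N N'"] elim: arrays_below_mono)
qed auto

definition foreign_arrays :: "nat \<Rightarrow> nat set" where
  "foreign_arrays N = {20..<20 + 2 * N}"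

text \<open>Only stores become dearer, with cost \<open>10 + 2 * expr_cost i + expr_cost e\<close>,
  and the factor 15 covers this. Each store adds one record, so the running time bounds the number
  of records and later the cost of cleaning.\<close>

lemma runs_recorded:
  assumes "runs c M t M'" "shifted M1 = M" "\<And>a. record_complete M1 a" "arrays_below N c"
  shows "exec (recorded c) M1 (15 * t)
    (\<lambda>M1'. shifted M1' = M' \<and> (\<forall>a. record_complete M1' a) \<and> same (foreign_arrays N) M1' M1 \<and>
       (\<forall>a. writes M1' a \<le> writes M1 a + int t))"
  using assms
proof (induction arbitrary: M1 rule: runs.induct)
  case (Skip M)
  then show ?case by (intro exec_loop_free) auto
next
  case (Store a i e M)
  have inv: "shifted (M1(21 + 2 * a := f)) = shifted M1" for f
    by (auto simp: shifted_def fun_eq_iff)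
  have sub: "{20 + 2 * a, 21 + 2 * a} \<subseteq> foreign_arrays N"
    using Store.prems by (auto simp: foreign_arrays_def)
  show ?case
    unfolding recorded.simps
    by (rule exec_mono[OF exec_recorded_store[OF _ _ Store.prems(2) order_refl]])
       (use Store.prems sub cost_pos[of i] cost_pos[of e] in
        \<open>auto simp: inv elim!: same_subset intro: order_trans\<close>)
next
  case (Seq c M t M' d u M'')
  show ?case
    unfolding recorded.simps
    by (rule exec_Seq[OF Seq.IH(1)[OF Seq.prems(1,2)] exec_mono[OF Seq.IH(2)]])
       (use Seq.prems(3) in \<open>auto intro: same_trans order_trans simp: algebra_simps\<close>)
next
  case (IfTrue b M c t M' d)
  have "eval_expr (shift_expr b) M1 > 0"
    using IfTrue.hyps(1) IfTrue.prems(1) by simp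
  then show ?case
    unfolding recorded.simps
    by (intro exec_IfPos[where T' = "15 * t"] exec_mono[OF IfTrue.IH[OF IfTrue.prems(1,2)]])
       (use IfTrue.prems(3) in \<open>auto intro: order_trans\<close>)
next
  case (IfFalse b M d t M' c)
  have "eval_expr (shift_expr b) M1 \<le> 0"
    using IfFalse.hyps(1) IfFalse.prems(1) by simp
  then show ?case
    unfolding recorded.simps
    by (intro exec_IfPos[where T' = "15 * t"] exec_mono[OF IfFalse.IH[OF IfFalse.prems(1,2)]])
       (use IfFalse.prems(3) in \<open>auto intro: order_trans\<close>)
next
  case (WhileTrue b M c t M' u M'')
  obtain t1 M2 where 1: "runs (recorded c) M1 t1 M2" "t1 \<le> 15 * t" "shifted M2 = M'"
    "\<And>a. record_complete M2 a" "same (foreign_arrays N) M2 M1"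
    "\<And>a. writes M2 a \<le> writes M1 a + int t"
    using WhileTrue.IH(1)[OF WhileTrue.prems(1,2)] WhileTrue.prems(3) by (auto simp: exec_def)
  obtain u1 M3 where 2: "runs (recorded (WhilePos b c)) M2 u1 M3" "u1 \<le> 15 * u" "shifted M3 = M''"
    "\<And>a. record_complete M3 a" "same (foreign_arrays N) M3 M2"
    "\<And>a. writes M3 a \<le> writes M2 a + int u"
    using WhileTrue.IH(2)[OF 1(3,4)] WhileTrue.prems(3) by (auto simp: exec_def)
  have "runs (recorded (WhilePos b c)) M1 (1 + expr_cost b + t1 + u1) M3"
    using runs.WhileTrue[of "shift_expr b" M1 "recorded c" t1 M2 u1 M3] 1 2 WhileTrue by simp
  moreover have "writes M3 a \<le> writes M1 a + int (1 + expr_cost b + t + u)" for a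
    using 1(6)[of a] 2(6)[of a] by simp
  ultimately show ?case
    using 1 2 by (intro execI) (auto intro: same_trans)
next
  case (WhileFalse b M c)
  have "runs (recorded (WhilePos b c)) M1 (1 + expr_cost b) M1"
    using runs.WhileFalse[of "shift_expr b" M1 "recorded c"] WhileFalse by simp
  then show ?case
    using WhileFalse by (intro execI) auto
qed

section \<open>Cleaning up after a call\<close>

definition clean_array :: "nat \<Rightarrow> prog" where
  "clean_array a =
     WhilePos (Cell (21 + 2 * a) (Const 0))
       (Seq (Store (20 + 2 * a) (Cell (21 + 2 * a) (Cell (21 + 2 * a) (Const 0))) (Const 0))
         (Store (21 + 2 * a) (Const 0) (Minus (Cell (21 + 2 * a) (Const 0)) (Const 1))))"

text \<open>Record slots above the counter may keep old addresses; \<open>record_complete\<close>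
  looks only at slots up to the counter.\<close>

definition clean :: "memory \<Rightarrow> nat \<Rightarrow> bool" where
  "clean M a \<longleftrightarrow> M (20 + 2 * a) = (\<lambda>_. 0) \<and> writes M a = 0"

text \<open>Records are popped from the top. A test costs 3 and the body at most 12, hence 15 per
  record and 3 for the last test.\<close>

lemma exec_clean_array:
  assumes "record_complete M a" "writes M a \<le> int k"
  shows "exec (clean_array a) M (15 * k + 3)
    (\<lambda>M'. clean M' a \<and> same {20 + 2 * a, 21 + 2 * a} M' M)"
  using assms
proof (induction k arbitrary: M)
  case 0
  then have w: "writes M a = 0"
    by (simp add: record_complete_def)
  then have "runs (clean_array a) M (1 + expr_cost (Cell (21 + 2 * a) (Const 0))) M"
    unfolding clean_array_def by (intro runs.WhileFalse) (simp add: writes_def)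
  moreover have "clean M a"
    using 0 w by (force simp: clean_def record_complete_def fun_eq_iff)
  ultimately show ?case by (intro execI) auto
next
  case (Suc k)
  show ?case
  proof (cases "writes M a = 0")
    case True
    then show ?thesis
      using Suc by (intro exec_mono[OF Suc.IH]) auto
  next
    case False
    let ?c = "writes M a"
    let ?M = "M(20 + 2 * a := (M (20 + 2 * a))(M (21 + 2 * a) ?c := 0),
      21 + 2 * a := (M (21 + 2 * a))(0 := ?c - 1))"
    let ?body = "Seq (Store (20 + 2 * a) (Cell (21 + 2 * a) (Cell (21 + 2 * a) (Const 0))) (Const 0))
         (Store (21 + 2 * a) (Const 0) (Minus (Cell (21 + 2 * a) (Const 0)) (Const 1)))"
    have pos: "?c > 0"
      using False Suc.prems by (simp add: record_complete_def)
    have w: "writes ?M a = ?c - 1"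
      by (simp add: writes_def)
    have "record_complete ?M a"
      unfolding record_complete_def w
    proof (intro conjI allI impI)
      fix i assume i: "?M (20 + 2 * a) i \<noteq> 0"
      then obtain j where j: "0 < j" "j \<le> ?c" "M (21 + 2 * a) j = i"
        using Suc.prems(1) by (auto simp: record_complete_def split: if_splits)
      \<comment> \<open>The address in the top slot has just been zeroed, so a cell that is still
        nonzero is recorded further down.\<close>
      then have "j \<noteq> ?c"
        using i by auto
      with j show "\<exists>j>0. j \<le> ?c - 1 \<and> ?M (21 + 2 * a) j = i"
        by (intro exI[of _ j]) auto
    qed (use pos in simp)
    then obtain u M' where u: "runs (clean_array a) ?M u M'" "u \<le> 15 * k + 3" "clean M' a"
      "same {20 + 2 * a, 21 + 2 * a} M' ?M"
      using Suc.IH[of ?M] Suc.prems(2) w by (auto simp: exec_def simp del: fun_upd_apply)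
    obtain t where t: "runs ?body M t ?M" "t \<le> 12"
    proof -
      have "exec ?body M 12 (\<lambda>M'. M' = ?M)"
        by (intro exec_loop_free) (simp_all add: writes_def fun_upd_twist)
      then show thesis using that by (auto simp: exec_def)
    qed
    have "runs (clean_array a) M (1 + expr_cost (Cell (21 + 2 * a) (Const 0)) + t + u) M'"
      using t(1) u(1) pos unfolding clean_array_def
      by (intro runs.WhileTrue) (simp_all add: writes_def)
    then show ?thesis
      using t(2) u(2-4) by (intro execI) (auto simp: same_def)
  qed
qed

primrec clean_arrays :: "nat \<Rightarrow> prog" where
  "clean_arrays 0 = Skip"
| "clean_arrays (Suc N) = Seq (clean_arrays N) (clean_array N)"

lemma clean_same: "same S M' M \<Longrightarrow> 20 + 2 * a \<notin> S \<Longrightarrow> 21 + 2 * a \<notin> S \<Longrightarrow> clean M' a = clean M a"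
  by (simp add: same_def clean_def writes_def)

lemma exec_clean_arrays:
  assumes "\<And>a. record_complete M a" "\<And>a. writes M a \<le> int k"
  shows "exec (clean_arrays N) M (N * (15 * k + 3) + 1)
    (\<lambda>M'. (\<forall>a<N. clean M' a) \<and> same (foreign_arrays N) M' M)"
proof (induction N)
  case 0
  show ?case by (auto intro: exec_loop_free)
next
  case (Suc N)
  show ?case
    unfolding clean_arrays.simps
  proof (rule exec_Seq[OF Suc exec_mono[OF exec_clean_array]])
    fix M' assume M': "(\<forall>a<N. clean M' a) \<and> same (foreign_arrays N) M' M"
    then have eq: "M' (20 + 2 * N) = M (20 + 2 * N)" "M' (21 + 2 * N) = M (21 + 2 * N)"
      by (auto simp: same_def foreign_arrays_def)
    then show "record_complete M' N" "writes M' N \<le> int k"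
      using assms[of N] by (simp_all add: record_complete_def writes_def)
    fix M'' assume M'': "clean M'' N \<and> same {20 + 2 * N, 21 + 2 * N} M'' M'"
    have "clean M'' a" if "a < N" for a
      using M' that M'' clean_same[of _ M'' M' a] by auto
    moreover have "same (foreign_arrays (Suc N)) M'' M"
      using M' M'' by (auto simp: same_def foreign_arrays_def)
    ultimately show "(\<forall>a<Suc N. clean M'' a) \<and> same (foreign_arrays (Suc N)) M'' M"
      using M'' by (auto simp: less_Suc_eq)
  qed auto
qed


section \<open>The clustering program\<close>

text \<open>Fixing zero at negative indices allows the content of a whole array to be stated as one
  equation between functions.\<close>

definition arr :: "(nat \<Rightarrow> int) \<Rightarrow> int \<Rightarrow> int" where
  "arr f i = (if 0 \<le> i then f (nat i) else 0)"

definition bits :: "nat set \<Rightarrow> int \<Rightarrow> int" where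
  "bits S = arr (\<lambda>w. if w \<in> S then 1 else 0)"

lemma arr_int [simp]: "arr f (int k) = f k"
  by (simp add: arr_def)

lemma arr_update [simp]: "(arr f)(int k := x) = arr (f(k := x))"
  by (auto simp: arr_def fun_eq_iff)

lemma bits_int [simp]: "bits S (int w) = (if w \<in> S then 1 else 0)"
  by (simp add: bits_def)

lemma bits_insert [simp]: "(bits S)(int w := 1) = bits (insert w S)"
  by (auto simp: bits_def arr_def fun_eq_iff)

lemma bits_remove [simp]: "(bits S)(int w := 0) = bits (S - {w})"
  by (auto simp: bits_def arr_def fun_eq_iff)

lemma bits_empty: "bits {} = (\<lambda>_. 0)"
  by (auto simp: bits_def arr_def fun_eq_iff)

abbreviation var :: "nat \<Rightarrow> expr" where
  "var a \<equiv> Cell a (Const 0)"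

abbreviation vertex_count :: expr where
  "vertex_count \<equiv> Cell 0 (Const 0)"

abbreviation edge_count :: expr where
  "edge_count \<equiv> Cell 0 (Const 1)"

text \<open>
  Arrays 0 to 3 hold the input. Array 4 holds the labels, 5 the indicator of the current vertex
  set, 6 the indices of the removed edges, 7 how often each index is removed, 8 the current vertex,
  14 the value of \<open>\<mu>\<close>, and 9 to 13 are scratch.
\<close>

definition relax_prog :: prog where
  "relax_prog = For 10 0 edge_count
     (IfPos (Cell 7 (var 10)) Skip
       (IfPos (Cell 5 (Cell 1 (var 10))) (Store 5 (Cell 2 (var 10)) (Const 1))
         (IfPos (Cell 5 (Cell 2 (var 10))) (Store 5 (Cell 1 (var 10)) (Const 1)) Skip)))"

definition component_prog :: prog where
  "component_prog =
     Seq (For 9 0 vertex_count (Store 5 (var 9) (Const 0)))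
       (Seq (Store 5 (var 8) (Const 1)) (For 9 0 vertex_count relax_prog))"

text \<open>Tests only ask for positivity, so equality with the label is tested by two strict
  comparisons. Array 11 receives the indicator of the class minus the cluster, and array 12 counts
  the edges whose ends differ there.\<close>

definition shrink_prog :: "nat \<Rightarrow> prog" where
  "shrink_prog q =
     Seq (For 9 0 vertex_count
           (IfPos (Minus (Cell 4 (var 9)) (Plus (var 13) (Const 1))) (Store 11 (var 9) (Const 0))
             (IfPos (Minus (Plus (var 13) (Const 1)) (Cell 4 (var 9))) (Store 11 (var 9) (Const 0))
               (Store 11 (var 9) (Minus (Const 1) (Cell 5 (var 9)))))))
       (Seq (Store 12 (Const 0) (Const 0))
         (Seq (For 9 0 edge_count
                (IfPos (Minus (Cell 11 (Cell 1 (var 9))) (Cell 11 (Cell 2 (var 9))))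
                  (Store 12 (Const 0) (Plus (var 12) (Const 1)))
                  (IfPos (Minus (Cell 11 (Cell 2 (var 9))) (Cell 11 (Cell 1 (var 9))))
                    (Store 12 (Const 0) (Plus (var 12) (Const 1))) Skip)))
           (IfPos (Minus (var 12) (Const (int q)))
             (For 9 0 vertex_count
               (IfPos (Minus (Cell 4 (var 9)) (Plus (var 13) (Const 1))) Skip
                 (IfPos (Minus (Plus (var 13) (Const 1)) (Cell 4 (var 9))) Skip
                   (Store 5 (var 9) (Const 0)))))
             Skip)))"

definition merge_prog :: "nat \<Rightarrow> prog" where
  "merge_prog q =
     Seq (For 13 0 vertex_count (shrink_prog q))
       (For 9 0 vertex_count
         (IfPos (Cell 5 (var 9)) (Store 4 (var 9) (Plus (var 8) (Const 1))) Skip))"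

text \<open>The input is copied by recorded stores as well, so that cleaning removes it together
  with the writes of the call.\<close>

definition load_prog :: prog where
  "load_prog =
     Seq (recorded_store 0 (Const 0) vertex_count)
       (Seq (recorded_store 0 (Const 1) edge_count)
         (Seq (For 9 0 edge_count
                (Seq (recorded_store 1 (var 9) (Cell 1 (var 9)))
                  (recorded_store 2 (var 9) (Cell 2 (var 9)))))
           (For 9 0 vertex_count (recorded_store 3 (var 9) (Cell 5 (var 9))))))"

definition measure_prog :: "prog \<Rightarrow> nat \<Rightarrow> prog" where
  "measure_prog c N =
     Seq load_prog (Seq (recorded c) (Seq (Store 14 (Const 0) (var 20)) (clean_arrays N)))"

definition visit_prog :: "prog \<Rightarrow> nat \<Rightarrow> nat \<Rightarrow> prog" where
  "visit_prog c N q =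
     IfPos (Cell 4 (var 8)) Skip
       (Seq component_prog
         (Seq (measure_prog c N) (IfPos (Minus (var 14) (var 3)) Skip (merge_prog q))))"

text \<open>Level \<open>j\<close> keeps its counter in cell \<open>j\<close> of array 6. Array 7
  must count removals instead of flagging them: two levels may choose the same edge, and undoing the
  inner choice must leave it removed.\<close>

primrec search_prog :: "prog \<Rightarrow> nat \<Rightarrow> nat \<Rightarrow> nat \<Rightarrow> prog" where
  "search_prog c N q 0 = visit_prog c N q"
| "search_prog c N q (Suc j) =
     For 6 (int j) (Plus edge_count (Const 1))
       (Seq (Store 7 (Cell 6 (Const (int j))) (Plus (Cell 7 (Cell 6 (Const (int j)))) (Const 1)))
         (Seq (search_prog c N q j)
           (Store 7 (Cell 6 (Const (int j))) (Minus (Cell 7 (Cell 6 (Const (int j)))) (Const 1)))))"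

text \<open>The verdict is gathered in array 14 and moved to cell 0 of array 0 last, because that
  cell holds the loop bound until then. Array 1 may be overwritten, as the edges are no longer
  read.\<close>

definition output_prog :: prog where
  "output_prog =
     Seq (Store 14 (Const 0) (Const 1))
       (Seq (For 9 0 vertex_count
              (Seq (IfPos (Cell 4 (var 9)) Skip (Store 14 (Const 0) (Const 0)))
                (Store 1 (var 9) (Cell 4 (var 9)))))
         (Store 0 (Const 0) (var 14)))"

definition partition_prog :: "prog \<Rightarrow> nat \<Rightarrow> nat \<Rightarrow> prog" where
  "partition_prog c N q = Seq (For 8 0 vertex_count (search_prog c N q q)) output_prog"

section \<open>Correctness and cost of the graph subroutines\<close>

context listed_graph
begin

text \<open>A common base for all cost bounds: the longest loop has \<open>m + 1\<close> iterations
  and needs \<open>m + 2 \<le> s\<close>.\<close>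

definition s :: nat where
  "s = n + m + 2"

lemma s_bounds: "Suc n \<le> s" "Suc m \<le> s" "Suc (Suc m) \<le> s" "2 \<le> s"
  by (simp_all add: s_def)

definition input :: "memory \<Rightarrow> bool" where
  "input M \<longleftrightarrow> M 0 0 = int n \<and> M 0 1 = int m \<and>
     M 1 = arr (\<lambda>e. if e < m then int (src e) else 0) \<and>
     M 2 = arr (\<lambda>e. if e < m then int (dst e) else 0)"

lemma inputD:
  assumes "input M"
  shows "M 0 0 = int n" "M 0 1 = int m" "e < m \<Longrightarrow> M 1 (int e) = int (src e)"
    "e < m \<Longrightarrow> M 2 (int e) = int (dst e)"
  using assms by (simp_all add: input_def)

lemma exec_relax:
  assumes M: "input M" "M 5 = bits S" "M 7 = arr r"
  shows "exec relax_prog M (54 * s)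
    (\<lambda>M'. M' 5 = bits (relax_round {e. r e > 0} S) \<and> same {5, 10} M' M)"
  unfolding relax_prog_def
proof (rule exec_For_power[where s = s and d = 0 and N = m and A = 40 and
    I = "\<lambda>i M'. M' 10 0 = int i \<and> M' 5 = bits (fold (relax_edge {e. r e > 0}) [0..<i] S) \<and>
      same {5, 10} M' M"])
  fix i M' assume i: "i < m" and I: "M' 10 0 = int i \<and>
      M' 5 = bits (fold (relax_edge {e. r e > 0}) [0..<i] S) \<and> same {5, 10} M' M"
  have "M' 1 (int i) = int (src i)" "M' 2 (int i) = int (dst i)" "M' 7 (int i) = r i"
    using I i M by (auto simp: same_def inputD simp del: One_nat_def)
  then show "exec (IfPos (Cell 7 (var 10)) Skip
       (IfPos (Cell 5 (Cell 1 (var 10))) (Store 5 (Cell 2 (var 10)) (Const 1))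
         (IfPos (Cell 5 (Cell 2 (var 10))) (Store 5 (Cell 1 (var 10)) (Const 1)) Skip))) M' (40 * s ^ 0)
    (\<lambda>M'. (M'(10 := (M' 10)(0 := M' 10 0 + 1))) 10 0 = int (Suc i) \<and>
      (M'(10 := (M' 10)(0 := M' 10 0 + 1))) 5 =
        bits (fold (relax_edge {e. r e > 0}) [0..<Suc i] S) \<and>
      same {5, 10} (M'(10 := (M' 10)(0 := M' 10 0 + 1))) M)"
    using I by (intro exec_loop_free) (auto simp: relax_edge_def)
qed (use M s_bounds in \<open>auto simp: relax_round_def same_def inputD\<close>)

lemma exec_component:
  assumes M: "input M" "M 5 = bits S" "S \<subseteq> {..<n}" "M 7 = arr r" "M 8 0 = int v" "v < n"
  shows "exec component_prog M (200 * s ^ 2)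
    (\<lambda>M'. M' 5 = bits (component {e. r e > 0} v) \<and> same {5, 9, 10} M' M)"
  unfolding component_prog_def
proof (rule exec_Seq)
  show "exec (For 9 0 vertex_count (Store 5 (var 9) (Const 0))) M (54 * s)
      (\<lambda>M'. M' 5 = bits {} \<and> same {5, 9, 10} M' M)"
  proof (rule exec_For_power[where s = s and d = 0 and N = n and A = 40 and
      I = "\<lambda>i M'. M' 9 0 = int i \<and> M' 5 = bits (S - {..<i}) \<and> same {5, 9, 10} M' M"])
    fix i M' assume "M' 9 0 = int i \<and> M' 5 = bits (S - {..<i}) \<and> same {5, 9, 10} M' M"
    moreover have "S - {..<i} - {i} = S - {..<Suc i}"
      by auto
    ultimately show "exec (Store 5 (var 9) (Const 0)) M' (40 * s ^ 0)
      (\<lambda>M'. (M'(9 := (M' 9)(0 := M' 9 0 + 1))) 9 0 = int (Suc i) \<and>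
         (M'(9 := (M' 9)(0 := M' 9 0 + 1))) 5 = bits (S - {..<Suc i}) \<and>
         same {5, 9, 10} (M'(9 := (M' 9)(0 := M' 9 0 + 1))) M)"
      by (intro exec_loop_free) simp_all
  next
    fix M' assume "M' 9 0 = int n \<and> M' 5 = bits (S - {..<n}) \<and> same {5, 9, 10} M' M"
    moreover have "S - {..<n} = {}"
      using M by auto
    ultimately show "M' 5 = bits {} \<and> same {5, 9, 10} M' M"
      by simp
  qed (use M s_bounds in \<open>auto simp: same_def inputD\<close>)
next
  fix M1 assume M1: "M1 5 = bits {} \<and> same {5, 9, 10} M1 M"
  show "exec (Seq (Store 5 (var 8) (Const 1)) (For 9 0 vertex_count relax_prog)) M1 (70 * s ^ 2)
    (\<lambda>M'. M' 5 = bits (component {e. r e > 0} v) \<and> same {5, 9, 10} M' M)"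
  proof (rule exec_Seq)
    show "exec (Store 5 (var 8) (Const 1)) M1 4 (\<lambda>M'. M' 5 = bits {v} \<and> same {5, 9, 10} M' M)"
      using M1 M bits_insert[of "{}" v] by (intro exec_loop_free) (auto simp: same_def simp del: bits_insert)
  next
    fix M2 assume M2: "M2 5 = bits {v} \<and> same {5, 9, 10} M2 M"
    show "exec (For 9 0 vertex_count relax_prog) M2 (68 * s ^ 2)
      (\<lambda>M'. M' 5 = bits (component {e. r e > 0} v) \<and> same {5, 9, 10} M' M)"
    proof (rule exec_For_power[where s = s and d = 1 and N = n and A = 54 and
        I = "\<lambda>i M'. M' 9 0 = int i \<and> M' 5 = bits ((relax_round {e. r e > 0} ^^ i) {v}) \<and>
          same {5, 9, 10} M' M"])
      fix i M' assume I: "M' 9 0 = int i \<and> M' 5 = bits ((relax_round {e. r e > 0} ^^ i) {v}) \<and>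
          same {5, 9, 10} M' M"
      have "input M'" "M' 7 = arr r"
        using I M by (auto simp: same_def input_def)
      from exec_relax[OF this(1) _ this(2), of "(relax_round {e. r e > 0} ^^ i) {v}"] I
      show "exec relax_prog M' (54 * s ^ 1)
        (\<lambda>M'. (M'(9 := (M' 9)(0 := M' 9 0 + 1))) 9 0 = int (Suc i) \<and>
           (M'(9 := (M' 9)(0 := M' 9 0 + 1))) 5 = bits ((relax_round {e. r e > 0} ^^ Suc i) {v}) \<and>
           same {5, 9, 10} (M'(9 := (M' 9)(0 := M' 9 0 + 1))) M)"
        by (auto simp: same_def elim!: exec_mono)
    qed (use M M2 s_bounds in \<open>auto simp: same_def inputD relax_iterate_component power2_eq_square\<close>)
  qed (use mult_le_mono[OF s_bounds(4) s_bounds(4)] in \<open>simp add: power2_eq_square\<close>)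
qed (use s_bounds in \<open>simp add: power2_eq_square\<close>)

lemma card_less_Suc: "card {e. e < Suc i \<and> P e} = card {e. e < i \<and> P e} + (if P i then 1 else 0)"
proof -
  have "{e. e < Suc i \<and> P e} = (if P i then insert i {e. e < i \<and> P e} else {e. e < i \<and> P e})"
    by (auto simp: less_Suc_eq)
  then show ?thesis by simp
qed

lemma exec_shrink:
  assumes M: "input M" "M 5 = bits C" "C \<subseteq> {..<n}" "M 4 = arr L" "M 13 0 = int l"
  shows "exec (shrink_prog q) M (180 * s)
    (\<lambda>M'. M' 5 = bits (shrink q L l C) \<and> same {5, 9, 11, 12} M' M)"
proof -
  let ?X = "label_class L (int l + 1) - C"
  show ?thesis
    unfolding shrink_prog_def
  proof (rule exec_Seq)
    let ?c = "IfPos (Minus (Cell 4 (var 9)) (Plus (var 13) (Const 1))) (Store 11 (var 9) (Const 0))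
             (IfPos (Minus (Plus (var 13) (Const 1)) (Cell 4 (var 9))) (Store 11 (var 9) (Const 0))
               (Store 11 (var 9) (Minus (Const 1) (Cell 5 (var 9)))))"
    let ?I = "\<lambda>i M'. M' 9 0 = int i \<and> (\<forall>w<i. M' 11 (int w) = (if w \<in> ?X then 1 else 0)) \<and>
          same {9, 11} M' M"
    show "exec (For 9 0 vertex_count ?c) M (54 * s)
      (\<lambda>M'. (\<forall>w<n. M' 11 (int w) = (if w \<in> ?X then 1 else 0)) \<and> same {9, 11} M' M)"
    proof (rule exec_For_power[where s = s and d = 0 and N = n and A = 40 and I = ?I])
      fix i M' assume i: "i < n" and I: "?I i M'"
      have "M' 4 = arr L" "M' 13 0 = int l" "M' 5 = bits C"
        using I M by (auto simp: same_def)
      then show "exec ?c M' (40 * s ^ 0) (\<lambda>M'. ?I (Suc i) (M'(9 := (M' 9)(0 := M' 9 0 + 1))))"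
        using I i by (intro exec_loop_free) (auto simp: less_Suc_eq label_class_def)
    qed (use M s_bounds in \<open>auto simp: same_def inputD\<close>)
  next
    fix M1 assume M1: "(\<forall>w<n. M1 11 (int w) = (if w \<in> ?X then 1 else 0)) \<and> same {9, 11} M1 M"
    let ?c = "IfPos (Minus (Cell 11 (Cell 1 (var 9))) (Cell 11 (Cell 2 (var 9))))
                  (Store 12 (Const 0) (Plus (var 12) (Const 1)))
                  (IfPos (Minus (Cell 11 (Cell 2 (var 9))) (Cell 11 (Cell 1 (var 9))))
                    (Store 12 (Const 0) (Plus (var 12) (Const 1))) Skip)"
    let ?d = "IfPos (Minus (var 12) (Const (int q)))
             (For 9 0 vertex_count
               (IfPos (Minus (Cell 4 (var 9)) (Plus (var 13) (Const 1))) Skip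
                 (IfPos (Minus (Plus (var 13) (Const 1)) (Cell 4 (var 9))) Skip
                   (Store 5 (var 9) (Const 0)))))
             Skip"
    show "exec (Seq (Store 12 (Const 0) (Const 0)) (Seq (For 9 0 edge_count ?c) ?d)) M1 (120 * s)
      (\<lambda>M'. M' 5 = bits (shrink q L l C) \<and> same {5, 9, 11, 12} M' M)"
    proof (rule exec_Seq)
      show "exec (Store 12 (Const 0) (Const 0)) M1 3
        (\<lambda>M'. M' 12 0 = 0 \<and> M' 11 = M1 11 \<and> same {9, 11, 12} M' M)"
        using M1 by (intro exec_loop_free) (auto simp: same_def)
    next
      fix M2 assume M2: "M2 12 0 = 0 \<and> M2 11 = M1 11 \<and> same {9, 11, 12} M2 M"
      show "exec (Seq (For 9 0 edge_count ?c) ?d) M2 (110 * s + 6)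
        (\<lambda>M'. M' 5 = bits (shrink q L l C) \<and> same {5, 9, 11, 12} M' M)"
      proof (rule exec_Seq)
        let ?P = "\<lambda>e. src e \<in> ?X \<longleftrightarrow> dst e \<notin> ?X"
        let ?I = "\<lambda>i M'. M' 9 0 = int i \<and> M' 11 = M1 11 \<and> M' 12 0 = int (card {e. e < i \<and> ?P e}) \<and>
          same {9, 11, 12} M' M"
        show "exec (For 9 0 edge_count ?c) M2 (54 * s)
          (\<lambda>M'. M' 12 0 = int (card (crossing ?X)) \<and> same {9, 11, 12} M' M)"
        proof (rule exec_For_power[where s = s and d = 0 and N = m and A = 40 and I = ?I])
          fix i M' assume i: "i < m" and I: "?I i M'"
          have "M' 1 (int i) = int (src i)" "M' 2 (int i) = int (dst i)"
            using I i M by (auto simp: same_def inputD simp del: One_nat_def)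
          moreover have "M' 11 (int (src i)) = (if src i \<in> ?X then 1 else 0)"
            "M' 11 (int (dst i)) = (if dst i \<in> ?X then 1 else 0)"
            using I M1 i by auto
          ultimately show "exec ?c M' (40 * s ^ 0)
              (\<lambda>M'. ?I (Suc i) (M'(9 := (M' 9)(0 := M' 9 0 + 1))))"
            unfolding card_less_Suc[of i ?P]
            using I i by (intro exec_loop_free) (simp_all split del: if_split, auto)
        qed (use M M2 s_bounds in \<open>auto simp: same_def inputD crossing_def\<close>)
      next
        fix M3 assume M3: "M3 12 0 = int (card (crossing ?X)) \<and> same {9, 11, 12} M3 M"
        let ?c = "IfPos (Minus (Cell 4 (var 9)) (Plus (var 13) (Const 1))) Skip
                 (IfPos (Minus (Plus (var 13) (Const 1)) (Cell 4 (var 9))) Skip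
                   (Store 5 (var 9) (Const 0)))"
        let ?I = "\<lambda>i M'. M' 9 0 = int i \<and>
          M' 5 = bits (C - (label_class L (int l + 1) \<inter> {..<i})) \<and> same {5, 9, 11, 12} M' M"
        have "exec (For 9 0 vertex_count ?c) M3 (54 * s)
          (\<lambda>M'. M' 5 = bits (C - label_class L (int l + 1)) \<and> same {5, 9, 11, 12} M' M)"
        proof (rule exec_For_power[where s = s and d = 0 and N = n and A = 40 and I = ?I])
          fix i M' assume i: "i < n" and I: "?I i M'"
          have "M' 4 = arr L" "M' 13 0 = int l"
            using I M by (auto simp: same_def)
          moreover have "C - (label_class L (int l + 1) \<inter> {..<Suc i}) =
            (if L i = int l + 1 then C - (label_class L (int l + 1) \<inter> {..<i}) - {i}
             else C - (label_class L (int l + 1) \<inter> {..<i}))"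
            using i by (auto simp: label_class_def less_Suc_eq)
          ultimately show "exec ?c M' (40 * s ^ 0)
              (\<lambda>M'. ?I (Suc i) (M'(9 := (M' 9)(0 := M' 9 0 + 1))))"
            using I i by (intro exec_loop_free) auto
        next
          fix M' assume "?I n M'"
          moreover have "label_class L (int l + 1) \<inter> {..<n} = label_class L (int l + 1)"
            by (auto simp: label_class_def)
          ultimately show "M' 5 = bits (C - label_class L (int l + 1)) \<and> same {5, 9, 11, 12} M' M"
            by simp
        qed (use M M3 s_bounds in \<open>auto simp: same_def inputD\<close>)
        then show "exec ?d M3 (54 * s + 6)
          (\<lambda>M'. M' 5 = bits (shrink q L l C) \<and> same {5, 9, 11, 12} M' M)"
          using M3 M
          by (intro exec_IfPos[where T' = "54 * s + 1"])
             (auto simp: shrink_def same_def elim!: exec_mono intro!: exec_loop_free[of Skip])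
      qed simp
    qed (use s_bounds in simp)
  qed simp
qed

lemma fold_shrink_subset: "fold (shrink q L) xs C \<subseteq> C"
  by (induction xs arbitrary: C) (auto simp: shrink_def)

lemma exec_merge:
  assumes M: "input M" "M 5 = bits C" "C \<subseteq> {..<n}" "M 4 = arr L" "M 8 0 = int v"
  shows "exec (merge_prog q) M (300 * s ^ 2)
    (\<lambda>M'. M' 4 = arr (merge q L C v) \<and> M' 5 = bits (uncross q L C) \<and>
      same {4, 5, 9, 11, 12, 13} M' M)"
  unfolding merge_prog_def
proof (rule exec_Seq)
  let ?I = "\<lambda>i M'. M' 13 0 = int i \<and> M' 5 = bits (fold (shrink q L) [0..<i] C) \<and>
    same {5, 9, 11, 12, 13} M' M"
  show "exec (For 13 0 vertex_count (shrink_prog q)) M (194 * s ^ 2)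
    (\<lambda>M'. M' 5 = bits (uncross q L C) \<and> same {5, 9, 11, 12, 13} M' M)"
  proof (rule exec_For_power[where s = s and d = 1 and N = n and A = 180 and I = ?I])
    fix i M' assume I: "?I i M'"
    have *: "input M'" "M' 4 = arr L"
      using I M by (auto simp: same_def input_def)
    show "exec (shrink_prog q) M' (180 * s ^ 1) (\<lambda>M'. ?I (Suc i) (M'(13 := (M' 13)(0 := M' 13 0 + 1))))"
      by (rule exec_mono[OF exec_shrink[where C = "fold (shrink q L) [0..<i] C", OF *(1) _ _ *(2)]])
         (use I M subset_trans[OF fold_shrink_subset M(3)] in \<open>auto simp: same_def\<close>)
  qed (use M s_bounds in \<open>auto simp: same_def inputD uncross_def power2_eq_square\<close>)
next
  fix M1 assume M1: "M1 5 = bits (uncross q L C) \<and> same {5, 9, 11, 12, 13} M1 M"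
  let ?c = "IfPos (Cell 5 (var 9)) (Store 4 (var 9) (Plus (var 8) (Const 1))) Skip"
  \<comment> \<open>The labelling after the first \<open>i\<close> vertices have been rewritten; it
    becomes \<open>merge q L C v\<close> at \<open>i = n\<close>, since the uncrossed set lies below
    \<open>n\<close>.\<close>
  let ?L = "\<lambda>i w. if w \<in> uncross q L C \<and> w < i then int v + 1 else L w"
  let ?I = "\<lambda>i M'. M' 9 0 = int i \<and> M' 4 = arr (?L i) \<and> M' 5 = bits (uncross q L C) \<and>
    same {4, 5, 9, 11, 12, 13} M' M"
  show "exec (For 9 0 vertex_count ?c) M1 (54 * s)
    (\<lambda>M'. M' 4 = arr (merge q L C v) \<and> M' 5 = bits (uncross q L C) \<and>
      same {4, 5, 9, 11, 12, 13} M' M)"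
  proof (rule exec_For_power[where s = s and d = 0 and N = n and A = 40 and I = ?I])
    fix i M' assume I: "?I i M'"
    have "M' 8 0 = int v"
      using I M by (auto simp: same_def)
    moreover have "?L (Suc i) = (if i \<in> uncross q L C then (?L i)(i := int v + 1) else ?L i)"
      by (auto simp: fun_eq_iff less_Suc_eq)
    ultimately show "exec ?c M' (40 * s ^ 0) (\<lambda>M'. ?I (Suc i) (M'(9 := (M' 9)(0 := M' 9 0 + 1))))"
      using I by (intro exec_loop_free) (auto simp del: fun_upd_apply simp: fun_upd_same fun_upd_other)
  next
    fix M' assume "?I n M'"
    moreover have "?L n = merge q L C v"
      using M(3) fold_shrink_subset[of q L "[0..<n]" C]
      by (auto simp: fun_eq_iff merge_def uncross_def)
    ultimately show "M' 4 = arr (merge q L C v) \<and> M' 5 = bits (uncross q L C) \<and>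
        same {4, 5, 9, 11, 12, 13} M' M"
      by simp
  qed (use M M1 s_bounds in \<open>auto simp: same_def inputD\<close>)
qed (use s_bounds in \<open>simp add: power2_eq_square\<close>)

end

lemma recorded_update [simp]:
  assumes "a < 20"
  shows "shifted (M(a := f)) = shifted M" "record_complete (M(a := f)) = record_complete M"
    "writes (M(a := f)) = writes M"
  using assms by (auto simp: shifted_def record_complete_def writes_def fun_eq_iff)

section \<open>Calling the program for the measure\<close>

locale computed_partition_search = partition_search +
  fixes c :: prog and N K k :: nat
  assumes computes: "\<And>X. X \<subseteq> {..<n} \<Longrightarrow>
      exec c (load (encode_graph G es @ [encode_subset G X])) (K * s ^ k) (\<lambda>M. M 0 0 = int (\<mu> G X))"
    and arrays: "arrays_below N c" "4 \<le> N"
begin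

text \<open>With a prefix of \<open>i\<close> edges and a partial set, the same formula serves as
  the invariant of both copying loops.\<close>

definition loaded :: "nat \<Rightarrow> nat set \<Rightarrow> memory" where
  "loaded i X = (\<lambda>_ _. 0)(0 := (\<lambda>_. 0)(0 := int n, 1 := int m),
     1 := arr (\<lambda>e. if e < i then int (src e) else 0),
     2 := arr (\<lambda>e. if e < i then int (dst e) else 0), 3 := bits X)"

lemma load_eq_loaded:
  assumes "X \<subseteq> {..<n}"
  shows "load (encode_graph G es @ [encode_subset G X]) = loaded m X"
proof (intro ext)
  fix a :: nat and i
  consider "a = 0" | "a = 1" | "a = 2" | "a = 3" | "a \<ge> 4"
    by linarith
  then show "load (encode_graph G es @ [encode_subset G X]) a i = loaded m X a i"
    using assms
    by cases (auto simp: load_def encode_graph_def encode_subset_def loaded_def num_edges_eq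
        bits_def arr_def nth_Cons' nat_less_iff)
qed

text \<open>\<open>V\<close> is the memory that the foreign program sees, and \<open>w\<close>
  bounds the records of each array. Relative to \<open>M0\<close> only the foreign arrays and the
  loop counter 9 may differ.\<close>

definition journal :: "memory \<Rightarrow> memory \<Rightarrow> nat \<Rightarrow> memory \<Rightarrow> bool" where
  "journal M0 V w M \<longleftrightarrow> shifted M = V \<and> (\<forall>a. record_complete M a) \<and> (\<forall>a. writes M a \<le> int w) \<and>
     same (insert 9 (foreign_arrays N)) M M0"

lemma journal_counter [simp]: "journal M0 V w (M(9 := f)) \<longleftrightarrow> journal M0 V w M"
  by (simp add: journal_def)

lemma journal_below:
  assumes "journal M0 V w M" "b < 20" "b \<noteq> 9"
  shows "M b = M0 b"
  using assms by (auto simp: journal_def same_def foreign_arrays_def)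

lemma exec_store_journal:
  assumes "journal M0 V w M" "a < N"
    and "\<And>f. eval_expr i (M(21 + 2 * a := f)) = eval_expr i M"
    and "\<And>f. eval_expr e (M(21 + 2 * a := f)) = eval_expr e M"
    and "expr_cost i \<le> 2" "expr_cost e \<le> 3"
  shows "exec (recorded_store a i e) M 17 (\<lambda>M'. M' 9 = M 9 \<and>
    journal M0 (V(a := (V a)(eval_expr i M := eval_expr e M))) (Suc w) M')"
proof (rule exec_mono[OF exec_recorded_store[OF assms(3,4) _ order_refl]])
  fix M'
  assume M': "shifted M' = (shifted M)(a := (shifted M a)(eval_expr i M := eval_expr e M)) \<and>
      (\<forall>b. record_complete M' b) \<and> same {20 + 2 * a, 21 + 2 * a} M' M \<and>
      (\<forall>b. writes M' b \<le> writes M b + 1)"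
  have "{20 + 2 * a, 21 + 2 * a} \<subseteq> insert 9 (foreign_arrays N)"
    using assms(2) by (auto simp: foreign_arrays_def)
  then have "same (insert 9 (foreign_arrays N)) M' M0"
    using M' assms(1) by (auto simp: journal_def intro: same_trans same_subset)
  moreover have "writes M' b \<le> int (Suc w)" for b
  proof -
    have "writes M' b \<le> writes M b + 1" "writes M b \<le> int w"
      using M' assms(1) by (auto simp: journal_def)
    then show ?thesis by simp
  qed
  ultimately show "M' 9 = M 9 \<and>
      journal M0 (V(a := (V a)(eval_expr i M := eval_expr e M))) (Suc w) M'"
    using M' assms(1) by (auto simp: journal_def same_def)
qed (use assms in \<open>auto simp: journal_def\<close>)

lemma exec_load:
  assumes M: "input M" "M 5 = bits X" "X \<subseteq> {..<n}" "\<And>a. clean M a"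
  shows "exec load_prog M (150 * s) (journal M (load (encode_graph G es @ [encode_subset G X])) (2 * s))"
  unfolding load_prog_def
proof (rule exec_Seq)
  let ?Z = "\<lambda>_ _. 0 :: int"
  have start: "journal M ?Z 0 M"
    using M(4) by (auto simp: journal_def shifted_def record_complete_def clean_def fun_eq_iff)
  show "exec (recorded_store 0 (Const 0) vertex_count) M 17
    (journal M (?Z(0 := (\<lambda>_. 0)(0 := int n))) 1)"
    by (rule exec_mono[OF exec_store_journal[OF start]])
       (use arrays M in \<open>auto simp: inputD\<close>)
  fix M1 assume M1: "journal M (?Z(0 := (\<lambda>_. 0)(0 := int n))) 1 M1"
  let ?c1 = "Seq (recorded_store 1 (var 9) (Cell 1 (var 9))) (recorded_store 2 (var 9) (Cell 2 (var 9)))"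
  let ?c2 = "recorded_store 3 (var 9) (Cell 5 (var 9))"
  show "exec (Seq (recorded_store 0 (Const 1) edge_count)
         (Seq (For 9 0 edge_count ?c1) (For 9 0 vertex_count ?c2))) M1 (108 * s + 17)
    (journal M (load (encode_graph G es @ [encode_subset G X])) (2 * s))"
  proof (rule exec_Seq)
    have "M1 0 = M 0"
      using journal_below[OF M1, of 0] by simp
    then have new: "?Z(0 := (\<lambda>_. 0)(0 := int n), 0 := ((?Z(0 := (\<lambda>_. 0)(0 := int n))) 0)
        (eval_expr (Const 1) M1 := eval_expr edge_count M1)) = loaded 0 {}"
      using M by (auto simp: loaded_def fun_eq_iff bits_def arr_def inputD)
    show "exec (recorded_store 0 (Const 1) edge_count) M1 17 (journal M (loaded 0 {}) 2)"
      by (rule exec_mono[OF exec_store_journal[OF M1, of 0 "Const 1" edge_count, unfolded new]])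
         (use arrays in \<open>auto simp: numeral_2_eq_2\<close>)
    fix M2 assume M2: "journal M (loaded 0 {}) 2 M2"
    show "exec (Seq (For 9 0 edge_count ?c1) (For 9 0 vertex_count ?c2)) M2 (54 * s + 54 * s)
      (journal M (load (encode_graph G es @ [encode_subset G X])) (2 * s))"
    proof (rule exec_Seq)
      \<comment> \<open>Two header cells plus two cells per edge; the \<open>n\<close> indicator
        cells follow, and \<open>2 + 2 * m + n \<le> 2 * s\<close>.\<close>
      let ?I = "\<lambda>i M'. M' 9 0 = int i \<and> journal M (loaded i {}) (2 + 2 * i) M'"
      show "exec (For 9 0 edge_count ?c1) M2 (54 * s) (journal M (loaded m {}) (2 + 2 * m))"
      proof (rule exec_For_power[where s = s and d = 0 and N = m and A = 40 and I = ?I])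
        fix i M' assume i: "i < m" and I: "?I i M'"
        have arr_i: "M' 1 = M 1"
          using I journal_below[of M _ _ M' 1] by auto
        show "exec ?c1 M' (40 * s ^ 0) (\<lambda>M'. ?I (Suc i) (M'(9 := (M' 9)(0 := M' 9 0 + 1))))"
        proof (rule exec_Seq)
          show "exec (recorded_store 1 (var 9) (Cell 1 (var 9))) M' 17
            (\<lambda>M'. M' 9 0 = int i \<and> journal M ((loaded i {})(1 := (loaded i {} 1)(int i := int (src i))))
              (Suc (2 + 2 * i)) M')"
            by (rule exec_mono[OF exec_store_journal])
               (use I arrays M i in \<open>auto simp: inputD arr_i simp del: One_nat_def\<close>)
          fix M'' assume M'': "M'' 9 0 = int i \<and>
            journal M ((loaded i {})(1 := (loaded i {} 1)(int i := int (src i)))) (Suc (2 + 2 * i)) M''"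
          have arr_i: "M'' 2 = M 2"
            using M'' journal_below[of M _ _ M'' 2] by auto
          have new: "(loaded i {})(1 := (loaded i {} 1)(int i := int (src i)),
              2 := (loaded i {} 2)(int i := int (dst i))) = loaded (Suc i) {}"
            by (auto simp: loaded_def fun_eq_iff arr_def less_Suc_eq)
          show "exec (recorded_store 2 (var 9) (Cell 2 (var 9))) M'' 17
            (\<lambda>M'. ?I (Suc i) (M'(9 := (M' 9)(0 := M' 9 0 + 1))))"
            by (rule exec_mono[OF exec_store_journal[OF conjunct2[OF M'']]])
               (use M'' arrays M i new in \<open>auto simp: inputD arr_i simp del: One_nat_def\<close>)
        qed simp
      next
        fix i M' assume "?I i M'"
        then show "M' 9 0 = int i \<and> eval_expr edge_count M' = int m"
          using journal_below[of M _ _ M' 0] M by (auto simp: inputD)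
      qed (use M2 M s_bounds in auto)
      fix M3 assume M3: "journal M (loaded m {}) (2 + 2 * m) M3"
      let ?I = "\<lambda>i M'. M' 9 0 = int i \<and> journal M (loaded m (X \<inter> {..<i})) (2 + 2 * m + i) M'"
      show "exec (For 9 0 vertex_count ?c2) M3 (54 * s)
        (journal M (load (encode_graph G es @ [encode_subset G X])) (2 * s))"
      proof (rule exec_For_power[where s = s and d = 0 and N = n and A = 40 and I = ?I])
        fix i M' assume i: "i < n" and I: "?I i M'"
        have arr_i: "M' 5 = M 5"
          using I journal_below[of M _ _ M' 5] by auto
        have new: "(loaded m (X \<inter> {..<i}))
            (3 := (loaded m (X \<inter> {..<i}) 3)(int i := if i \<in> X then 1 else 0)) =
            loaded m (X \<inter> {..<Suc i})"
          by (auto simp: loaded_def fun_eq_iff bits_def arr_def less_Suc_eq)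
        show "exec ?c2 M' (40 * s ^ 0) (\<lambda>M'. ?I (Suc i) (M'(9 := (M' 9)(0 := M' 9 0 + 1))))"
          by (rule exec_mono[OF exec_store_journal[OF conjunct2[OF I]]])
             (use I arrays M i new in \<open>auto simp: arr_i\<close>)
      next
        fix i M' assume "?I i M'"
        then show "M' 9 0 = int i \<and> eval_expr vertex_count M' = int n"
          using journal_below[of M _ _ M' 0] M by (auto simp: inputD)
      next
        fix M' assume "?I n M'"
        moreover have "X \<inter> {..<n} = X"
          using M by auto
        ultimately show "journal M (load (encode_graph G es @ [encode_subset G X])) (2 * s) M'"
          using M by (auto simp: load_eq_loaded journal_def s_def intro: order_trans)
      qed (use M3 M s_bounds in auto)
    qed simp
  qed simp
qed (use s_bounds in simp)

text \<open>The summands pay for loading and bookkeeping, for the recorded call, and for cleaning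
  \<open>N\<close> arrays with at most \<open>2 * s + K * s ^ k\<close> records each.\<close>

definition measure_factor :: nat where
  "measure_factor = 200 + 15 * K + N * (15 * (K + 2) + 3)"

lemma exec_measure:
  assumes M: "input M" "M 5 = bits X" "X \<subseteq> {..<n}" "\<And>a. clean M a"
  shows "exec (measure_prog c N) M (measure_factor * s ^ Suc k)
    (\<lambda>M'. M' 14 0 = int (\<mu> G X) \<and> (\<forall>a. clean M' a) \<and>
       same (insert 9 (insert 14 (foreign_arrays N))) M' M)"
proof -
  obtain t Mc where c: "runs c (load (encode_graph G es @ [encode_subset G X])) t Mc"
    "t \<le> K * s ^ k" "Mc 0 0 = int (\<mu> G X)"
    using computes[OF M(3)] by (auto simp: exec_def)
  let ?w = "2 * s + K * s ^ k"
  have pow: "s \<le> s ^ Suc k" "s ^ k \<le> s ^ Suc k" "1 \<le> s ^ Suc k"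
    using s_bounds(4) by simp_all
  have "?w \<le> (K + 2) * s ^ Suc k"
    using pow(1) mult_le_mono2[OF pow(2), of K] unfolding distrib_right by linarith
  then have "N * (15 * ?w + 3) + 1 \<le> N * (15 * ((K + 2) * s ^ Suc k) + 3 * s ^ Suc k) + s ^ Suc k"
    using pow(3) by (intro add_mono mult_le_mono2) auto
  moreover have "15 * (K * s ^ k) \<le> 15 * (K * s ^ Suc k)"
    using pow(2) by (intro mult_le_mono2)
  ultimately have cost:
    "150 * s + (15 * (K * s ^ k) + (5 + (N * (15 * ?w + 3) + 1))) \<le> measure_factor * s ^ Suc k"
    using pow unfolding measure_factor_def distrib_right distrib_left mult.assoc by linarith
  show ?thesis
    unfolding measure_prog_def
  proof (rule exec_Seq[OF exec_load[OF M]])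
    fix M1 assume M1: "journal M (load (encode_graph G es @ [encode_subset G X])) (2 * s) M1"
    show "exec (Seq (recorded c) (Seq (Store 14 (Const 0) (var 20)) (clean_arrays N))) M1
      (15 * (K * s ^ k) + (5 + (N * (15 * ?w + 3) + 1)))
      (\<lambda>M'. M' 14 0 = int (\<mu> G X) \<and> (\<forall>a. clean M' a) \<and>
         same (insert 9 (insert 14 (foreign_arrays N))) M' M)"
    proof (rule exec_Seq)
      show "exec (recorded c) M1 (15 * (K * s ^ k)) (journal M Mc ?w)"
      proof (rule exec_mono[OF runs_recorded[OF c(1) _ _ arrays(1)]])
        fix M2 assume M2: "shifted M2 = Mc \<and> (\<forall>a. record_complete M2 a) \<and>
          same (foreign_arrays N) M2 M1 \<and> (\<forall>a. writes M2 a \<le> writes M1 a + int t)"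
        have "writes M2 a \<le> int ?w" for a
        proof -
          have "writes M2 a \<le> writes M1 a + int t" "writes M1 a \<le> int (2 * s)"
            using M2 M1 by (auto simp: journal_def)
          moreover have "int t \<le> int (K * s ^ k)"
            using c(2) by (simp only: of_nat_le_iff)
          ultimately show ?thesis by simp
        qed
        then show "journal M Mc ?w M2"
          using M1 M2 by (auto simp: journal_def same_def)
      qed (use M1 c(2) in \<open>auto simp: journal_def\<close>)
      fix M2 assume M2: "journal M Mc ?w M2"
      let ?M = "M2(14 := (M2 14)(0 := int (\<mu> G X)))"
      show "exec (Seq (Store 14 (Const 0) (var 20)) (clean_arrays N)) M2
        (5 + (N * (15 * ?w + 3) + 1))
        (\<lambda>M'. M' 14 0 = int (\<mu> G X) \<and> (\<forall>a. clean M' a) \<and>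
           same (insert 9 (insert 14 (foreign_arrays N))) M' M)"
      proof (rule exec_Seq)
        have "M2 20 = Mc 0"
          using M2 by (auto simp: journal_def shifted_def)
        then show "exec (Store 14 (Const 0) (var 20)) M2 5 (\<lambda>M'. M' = ?M)"
          using c(3) by (intro exec_loop_free) simp_all
        fix M3 assume M3: "M3 = ?M"
        show "exec (clean_arrays N) M3 (N * (15 * ?w + 3) + 1)
          (\<lambda>M'. M' 14 0 = int (\<mu> G X) \<and> (\<forall>a. clean M' a) \<and>
             same (insert 9 (insert 14 (foreign_arrays N))) M' M)"
        proof (rule exec_mono[OF exec_clean_arrays order_refl])
          show "record_complete M3 a" "writes M3 a \<le> int ?w" for a
            using M2 M3 by (simp_all add: journal_def)
          fix M' assume M': "(\<forall>a<N. clean M' a) \<and> same (foreign_arrays N) M' M3"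
          then have frame: "same (insert 9 (insert 14 (foreign_arrays N))) M' M"
            using M2 M3 by (auto simp: journal_def same_def)
          \<comment> \<open>Arrays from \<open>N\<close> on are touched neither by the call nor by
            the cleaning, so they stay as clean as before.\<close>
          have "clean M' a" if "\<not> a < N" for a
            using that M(4)[of a] clean_same[OF frame, of a] by (auto simp: foreign_arrays_def)
          moreover have "M' 14 = M3 14"
            using M' by (auto simp: same_def foreign_arrays_def)
          ultimately show "M' 14 0 = int (\<mu> G X) \<and> (\<forall>a. clean M' a) \<and>
              same (insert 9 (insert 14 (foreign_arrays N))) M' M"
            using M' M3 frame by auto
        qed
      qed simp
    qed simp
  qed (rule cost)
qed

section \<open>The nested search and the whole program\<close>

text \<open>The state between two visits. Array 5 may hold any set left behind, provided it lies
  below \<open>n\<close>, because \<open>component_prog\<close> clears only these cells.\<close>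

definition ready :: "nat \<Rightarrow> (nat \<Rightarrow> int) \<Rightarrow> (nat \<Rightarrow> int) \<Rightarrow> memory \<Rightarrow> bool" where
  "ready v L r M \<longleftrightarrow> input M \<and> M 3 0 = p \<and> M 8 0 = int v \<and> M 4 = arr L \<and> M 7 = arr r \<and>
     (\<exists>C\<subseteq>{..<n}. M 5 = bits C) \<and> (\<forall>a. clean M a)"

definition visit_factor :: nat where
  "visit_factor = measure_factor + 520"

lemma clean_update [simp]: "a < 20 \<Longrightarrow> clean (M(a := f)) = clean M"
  by (auto simp: clean_def writes_def fun_eq_iff)

lemma clean_frame: "same S M' M \<Longrightarrow> S \<subseteq> {..<20} \<Longrightarrow> clean M' a \<longleftrightarrow> clean M a"
  by (rule clean_same) auto

lemma exec_visit:
  assumes M: "ready v L r M" "v < n"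
  shows "exec (visit_prog c N q) M (visit_factor * s ^ (k + 2))
    (\<lambda>M'. ready v (visit v {e. r e > 0} L) r M' \<and> M' 6 = M 6)"
proof -
  define C where "C = component {e. r e > 0} v"
  define Q where "Q M' \<longleftrightarrow> ready v (visit v {e. r e > 0} L) r M' \<and> M' 6 = M 6" for M'
  have pow: "s ^ 2 \<le> s ^ (k + 2)" "s ^ Suc k \<le> s ^ (k + 2)" "1 \<le> s ^ (k + 2)"
    using s_bounds(4) by (auto intro: power_increasing simp del: power_Suc)
  have C: "C \<subseteq> {..<n}"
    unfolding C_def by (rule component_verts[OF M(2)])
  have test: "eval_expr (Cell 4 (var 8)) M = L v"
    using M by (simp add: ready_def)
  obtain C0 where C0: "C0 \<subseteq> {..<n}" "M 5 = bits C0"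
    using M by (auto simp: ready_def)
  have main: "exec (Seq component_prog
      (Seq (measure_prog c N) (IfPos (Minus (var 14) (var 3)) Skip (merge_prog q)))) M
      (200 * s ^ 2 + (measure_factor * s ^ Suc k + (6 + (1 + 300 * s ^ 2)))) Q"
    if L: "L v \<le> 0"
  proof (rule exec_Seq)
    show "exec component_prog M (200 * s ^ 2) (\<lambda>M'. M' 5 = bits C \<and> same {5, 9, 10} M' M)"
      unfolding C_def by (rule exec_component[where M = M and S = C0 and r = r and v = v, OF _ C0(2,1)]) (use M in \<open>auto simp: ready_def\<close>)
    fix M1 assume M1: "M1 5 = bits C \<and> same {5, 9, 10} M1 M"
    have clean1: "clean M1 a" for a
      using clean_frame[OF conjunct2[OF M1]] M by (auto simp: ready_def)
    have input1: "input M1"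
      using M1 M by (auto simp: ready_def input_def same_def)
    show "exec (Seq (measure_prog c N) (IfPos (Minus (var 14) (var 3)) Skip (merge_prog q))) M1
      (measure_factor * s ^ Suc k + (6 + (1 + 300 * s ^ 2))) Q"
    proof (rule exec_Seq[OF exec_measure[OF input1 conjunct1[OF M1] C clean1]])
      fix M2 assume M2: "M2 14 0 = int (\<mu> G C) \<and> (\<forall>a. clean M2 a) \<and>
        same (insert 9 (insert 14 (foreign_arrays N))) M2 M1"
      have frame: "M2 a = M a" if "a < 20" "a \<notin> {5, 9, 10, 14}" for a
        using that M1 M2 by (auto simp: same_def foreign_arrays_def)
      have M2_5: "M2 5 = bits C"
        using M1 M2 by (auto simp: same_def foreign_arrays_def)
      have state: "input M2" "M2 3 0 = p" "M2 8 0 = int v" "M2 4 = arr L" "M2 7 = arr r" "M2 6 = M 6"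
        using M by (simp_all add: frame ready_def input_def)
      show "exec (IfPos (Minus (var 14) (var 3)) Skip (merge_prog q)) M2 (6 + (1 + 300 * s ^ 2)) Q"
      proof (rule exec_IfPos[where T' = "1 + 300 * s ^ 2"])
        assume "eval_expr (Minus (var 14) (var 3)) M2 > 0"
        then have "visit v {e. r e > 0} L = L"
          using M2 state by (simp add: visit_def C_def)
        then show "exec Skip M2 (1 + 300 * s ^ 2) Q"
          using M2 M2_5 C state by (intro exec_loop_free) (auto simp: Q_def ready_def)
      next
        assume "eval_expr (Minus (var 14) (var 3)) M2 \<le> 0"
        then have visit: "visit v {e. r e > 0} L = merge q L C v"
          using M2 state L by (simp add: visit_def C_def)
        show "exec (merge_prog q) M2 (1 + 300 * s ^ 2) Q"
        proof (rule exec_mono[OF exec_merge[OF state(1) M2_5 C state(4,3)]])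
          fix M' assume M': "M' 4 = arr (merge q L C v) \<and> M' 5 = bits (uncross q L C) \<and>
            same {4, 5, 9, 11, 12, 13} M' M2"
          then have "clean M' a" for a
            using clean_frame[of _ M' M2 a] M2 by auto
          moreover have "uncross q L C \<subseteq> {..<n}"
            using C fold_shrink_subset[of q L "[0..<n]" C] by (auto simp: uncross_def)
          moreover have "input M'" "M' 3 = M2 3" "M' 8 = M2 8" "M' 7 = M2 7" "M' 6 = M2 6"
            using M' state(1) by (auto simp: same_def input_def)
          ultimately show "Q M'"
            using M' state by (auto simp: Q_def ready_def visit)
        qed simp
      qed simp
    qed simp
  qed simp
  have "exec (visit_prog c N q) M (visit_factor * s ^ (k + 2)) Q"
    unfolding visit_prog_def
  proof (rule exec_IfPos)
    assume "eval_expr (Cell 4 (var 8)) M > 0"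
    then have "visit v {e. r e > 0} L = L"
      by (simp only: test visit_def) auto
    then show "exec Skip M (200 * s ^ 2 + (measure_factor * s ^ Suc k + (6 + (1 + 300 * s ^ 2)))) Q"
      using M by (intro exec_loop_free) (auto simp: Q_def)
  next
    have "measure_factor * s ^ Suc k \<le> measure_factor * s ^ (k + 2)"
      using pow(2) by (rule mult_le_mono2)
    moreover have "expr_cost (Cell 4 (var 8)) = 3"
      by simp
    ultimately show "1 + expr_cost (Cell 4 (var 8)) +
        (200 * s ^ 2 + (measure_factor * s ^ Suc k + (6 + (1 + 300 * s ^ 2)))) \<le>
        visit_factor * s ^ (k + 2)"
      using pow unfolding visit_factor_def distrib_right by linarith
  qed (use main test in simp)
  then show ?thesis by (simp add: Q_def[abs_def])
qed

lemma ready_removal: "ready v L r M \<Longrightarrow> ready v L r' (M(7 := arr r'))"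
  by (simp add: ready_def input_def)

text \<open>Lower levels use only counters below \<open>j\<close>, so those of the enclosing loops
  survive, and \<open>r\<close> is restored on exit. The 30 per level is 8 for each update of array
  7 plus the loop overhead of 14.\<close>

lemma exec_search:
  assumes "ready v L r M" "v < n"
  shows "exec (search_prog c N q j) M ((visit_factor + 30 * j) * s ^ (k + 2 + j))
    (\<lambda>M'. ready v (search v j r L) r M' \<and> (\<forall>i\<ge>j. M' 6 (int i) = M 6 (int i)))"
  using assms(1)
proof (induction j arbitrary: L r M)
  case 0
  then show ?case
    using exec_mono[OF exec_visit[OF _ assms(2)]] by simp
next
  case (Suc j)
  let ?f = "\<lambda>x. search v j (r(x := r x + 1))"
  let ?I = "\<lambda>i M'. M' 6 (int j) = int i \<and> ready v (fold ?f [0..<i] L) r M' \<and>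
    (\<forall>i\<ge>Suc j. M' 6 (int i) = M 6 (int i))"
  let ?c = "search_prog c N q j"
  let ?inc = "Store 7 (Cell 6 (Const (int j))) (Plus (Cell 7 (Cell 6 (Const (int j)))) (Const 1))"
  let ?dec = "Store 7 (Cell 6 (Const (int j))) (Minus (Cell 7 (Cell 6 (Const (int j)))) (Const 1))"
  let ?A = "visit_factor + 30 * j" and ?d = "k + 2 + j"
  have ready_6: "ready v L r (M(6 := f)) = ready v L r M" for L r M f
    by (simp add: ready_def input_def)
  show ?case
    unfolding search_prog.simps
  proof (rule exec_For_power[where s = s and d = ?d and N = "Suc m" and A = "?A + 16" and I = ?I])
    fix i M1 assume i: "i < Suc m" and I: "?I i M1"
    let ?r = "r(i := r i + 1)" and ?L = "fold ?f [0..<i] L"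
    show "exec (Seq ?inc (Seq ?c ?dec)) M1 ((?A + 16) * s ^ ?d)
      (\<lambda>M'. ?I (Suc i) (M'(6 := (M' 6)(int j := M' 6 (int j) + 1))))"
    proof (rule exec_Seq)
      have "M1 7 = arr r"
        using I by (simp add: ready_def)
      then show "exec ?inc M1 8 (\<lambda>M'. ready v ?L ?r M' \<and> M' 6 = M1 6)"
        using I ready_removal[of v ?L r M1 ?r] by (intro exec_loop_free) auto
      fix M2 assume M2: "ready v ?L ?r M2 \<and> M2 6 = M1 6"
      show "exec (Seq ?c ?dec) M2 (?A * s ^ ?d + 8)
        (\<lambda>M'. ?I (Suc i) (M'(6 := (M' 6)(int j := M' 6 (int j) + 1))))"
      proof (rule exec_Seq[OF Suc.IH[OF conjunct1[OF M2]]])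
        fix M3 assume M3: "ready v (search v j ?r ?L) ?r M3 \<and> (\<forall>i\<ge>j. M3 6 (int i) = M2 6 (int i))"
        have "M3 7 = arr ?r" "M3 6 (int j) = int i"
          using M3 M2 I by (auto simp: ready_def)
        moreover have "ready v (search v j ?r ?L) r (M3(7 := arr r))"
          using M3 ready_removal by blast
        moreover have "?r(i := ?r i - 1) = r"
          by auto
        ultimately show "exec ?dec M3 8
            (\<lambda>M'. ?I (Suc i) (M'(6 := (M' 6)(int j := M' 6 (int j) + 1))))"
          using I M2 M3
          by (intro exec_loop_free) (auto simp: ready_6 simp del: fun_upd_apply, auto)
      qed simp
    next
      have "1 \<le> s ^ ?d"
        using s_bounds(4) by simp
      then show "8 + (?A * s ^ ?d + 8) \<le> (?A + 16) * s ^ ?d"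
        unfolding distrib_right by linarith
    qed
  next
    fix M' assume I: "?I (Suc m) M'"
    then show "ready v (search v (Suc j) r L) r M' \<and> (\<forall>i\<ge>Suc j. M' 6 (int i) = M 6 (int i))"
      unfolding search.simps by blast
  next
    fix i M' assume "?I i M'"
    then show "M' 6 (int j) = int i \<and> eval_expr (Plus edge_count (Const 1)) M' = int (Suc m)"
      by (auto simp: ready_def inputD)
  qed (use Suc.prems s_bounds in \<open>auto simp: ready_6 algebra_simps\<close>)
qed

lemma exec_output:
  assumes M: "ready v L r M"
  shows "exec output_prog M (60 * s)
    (\<lambda>M'. M' 0 0 = (if \<forall>v<n. L v > 0 then 1 else 0) \<and> (\<forall>v<n. M' 1 (int v) = L v))"
  unfolding output_prog_def
proof (rule exec_Seq)
  show "exec (Store 14 (Const 0) (Const 1)) M 3 (\<lambda>M'. M' 14 0 = 1 \<and> same {1, 9, 14} M' M)"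
    by (intro exec_loop_free) auto
  fix M1 assume M1: "M1 14 0 = 1 \<and> same {1, 9, 14} M1 M"
  let ?c = "Seq (IfPos (Cell 4 (var 9)) Skip (Store 14 (Const 0) (Const 0)))
                (Store 1 (var 9) (Cell 4 (var 9)))"
  let ?I = "\<lambda>i M'. M' 9 0 = int i \<and> M' 14 0 = (if \<forall>v<i. L v > 0 then 1 else 0) \<and>
    (\<forall>v<i. M' 1 (int v) = L v) \<and> same {1, 9, 14} M' M"
  let ?R = "\<lambda>M'. M' 14 0 = (if \<forall>v<n. L v > 0 then 1 else 0) \<and> (\<forall>v<n. M' 1 (int v) = L v)"
  show "exec (Seq (For 9 0 vertex_count ?c) (Store 0 (Const 0) (var 14))) M1 (54 * s + 5)
    (\<lambda>M'. M' 0 0 = (if \<forall>v<n. L v > 0 then 1 else 0) \<and> (\<forall>v<n. M' 1 (int v) = L v))"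
  proof (rule exec_Seq)
    show "exec (For 9 0 vertex_count ?c) M1 (54 * s) ?R"
    proof (rule exec_For_power[where s = s and d = 0 and N = n and A = 40 and I = ?I])
      fix i M' assume I: "?I i M'"
      then have "M' 4 = arr L"
        using M by (auto simp: ready_def same_def)
      then show "exec ?c M' (40 * s ^ 0) (\<lambda>M'. ?I (Suc i) (M'(9 := (M' 9)(0 := M' 9 0 + 1))))"
        using I by (intro exec_loop_free) (auto simp: less_Suc_eq)
    next
      fix i M' assume "?I i M'"
      then show "M' 9 0 = int i \<and> eval_expr vertex_count M' = int n"
        using M by (auto simp: ready_def same_def inputD)
    qed (use M1 s_bounds in auto)
    show "exec (Store 0 (Const 0) (var 14)) M' 5
      (\<lambda>M'. M' 0 0 = (if \<forall>v<n. L v > 0 then 1 else 0) \<and> (\<forall>v<n. M' 1 (int v) = L v))"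
      if "?R M'" for M'
      using that by (intro exec_loop_free) auto
  qed simp
qed (use s_bounds in simp)

definition total_factor :: nat where
  "total_factor = visit_factor + 30 * q + 74"

lemma ready_load: "ready 0 (\<lambda>_. 0) (\<lambda>_. 0) ((load (encode_graph G es @ [[p]]))(8 := (\<lambda>_. 0)))"
proof -
  let ?M = "load (encode_graph G es @ [[p]])"
  have zero: "?M a = (\<lambda>_. 0)" if "a \<ge> 4" for a
    using that by (auto simp: load_def encode_graph_def fun_eq_iff)
  have arr_0: "arr (\<lambda>_. 0) = (\<lambda>_. 0)"
    by (simp add: arr_def fun_eq_iff)
  have "?M 1 = arr (\<lambda>e. if e < m then int (src e) else 0)"
    "?M 2 = arr (\<lambda>e. if e < m then int (dst e) else 0)"
    by (auto simp: load_def encode_graph_def arr_def fun_eq_iff nat_less_iff)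
  moreover have "?M 0 0 = int n" "?M 0 1 = int m" "?M 3 0 = p"
    by (simp_all add: load_def encode_graph_def num_edges_eq)
  ultimately show ?thesis
    using zero bits_empty
    by (auto simp: ready_def input_def arr_0 clean_def writes_def intro!: exI[of _ "{}"])
qed

lemma exec_partition:
  "exec (partition_prog c N q) (load (encode_graph G es @ [[p]]))
    (total_factor * s ^ (k + 3 + q)) (correct_answer \<mu> p (int q) G)"
  unfolding partition_prog_def
proof (rule exec_Seq)
  let ?f = "\<lambda>v. search v q (\<lambda>_. 0)"
  let ?I = "\<lambda>i M. ready i (fold ?f [0..<i] (\<lambda>_. 0)) (\<lambda>_. 0) M"
  show "exec (For 8 0 vertex_count (search_prog c N q q)) (load (encode_graph G es @ [[p]]))
    ((visit_factor + 30 * q + 14) * s ^ (k + 3 + q)) (ready n labelling (\<lambda>_. 0))"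
  proof (rule exec_For_power[where s = s and d = "k + 2 + q" and N = n and A = "visit_factor + 30 * q" and I = ?I])
    have "(load (encode_graph G es @ [[p]]) 8)(0 := 0) = (\<lambda>_. 0)"
      by (auto simp: load_def encode_graph_def fun_eq_iff)
    then show "?I 0 ((load (encode_graph G es @ [[p]]))
        (8 := (load (encode_graph G es @ [[p]]) 8)(0 := 0)))"
      using ready_load by simp
    fix i M assume i: "i < n" and I: "?I i M"
    show "exec (search_prog c N q q) M ((visit_factor + 30 * q) * s ^ (k + 2 + q))
      (\<lambda>M'. ?I (Suc i) (M'(8 := (M' 8)(0 := M' 8 0 + 1))))"
      by (rule exec_mono[OF exec_search[OF I i]]) (auto simp: ready_def input_def)
  qed (use s_bounds in \<open>auto simp: labelling_def ready_def inputD numeral_3_eq_3\<close>)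
  fix M assume M: "ready n labelling (\<lambda>_. 0) M"
  show "exec output_prog M (60 * s) (correct_answer \<mu> p (int q) G)"
  proof (rule exec_mono[OF exec_output[OF M]])
    fix M' :: memory
    assume M': "M' 0 0 = (if \<forall>v<n. labelling v > 0 then 1 else 0) \<and>
      (\<forall>v<n. M' 1 (int v) = labelling v)"
    show "correct_answer \<mu> p (int q) G M'"
    proof (cases "\<forall>v<n. labelling v > 0")
      case True
      then show ?thesis
        using covered_partition[of "M' 1"] M' by (auto simp: correct_answer_def)
    next
      case False
      then show ?thesis
        using partition_covered M' by (auto simp: correct_answer_def)
    qed
  qed simp
next
  have "s \<le> s ^ (k + 3 + q)"
    using s_bounds(4) power_increasing[of 1 "k + 3 + q" s] by simp
  then show "(visit_factor + 30 * q + 14) * s ^ (k + 3 + q) + 60 * s \<le> total_factor * s ^ (k + 3 + q)"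
    unfolding total_factor_def distrib_right by linarith
qed

end

text \<open>Edges are distinct pairs of vertices, so \<open>m \<le> n * n\<close>; this turns powers
  of \<open>s\<close> into powers of \<open>n\<close> with doubled exponent.\<close>

lemma (in listed_graph) s_le: "s \<le> 4 * max 1 n ^ 2"
proof -
  let ?x = "max 1 n"
  have "n * n \<le> ?x * ?x"
    by (intro mult_le_mono) auto
  moreover have "n \<le> ?x * ?x" "1 \<le> ?x * ?x"
    by (rule le_trans[OF _ le_square], simp)+
  ultimately show ?thesis
    using edges_le unfolding s_def power2_eq_square by linarith
qed

lemma solves_nonneg:
  assumes "monotone_measure \<mu>"
    and calls: "\<And>G es X. simple_graph G \<Longrightarrow> edge_list_of G es \<Longrightarrow> X \<subseteq> verts G \<Longrightarrow>
      \<exists>t M. runs c (load (encode_graph G es @ [encode_subset G X])) t M \<and>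
        M 0 0 = int (\<mu> G X) \<and> t \<le> K * (num_verts G + num_edges G + 1) ^ k"
  shows "\<exists>c K. solves_partition_problem \<mu> (int q)
    (\<lambda>n m. K * max 1 n ^ (2 * (k + 3 + q)) * max 1 m) c"
proof -
  obtain N0 where "arrays_below N0 c"
    using arrays_below_exists by blast
  then have N: "arrays_below (N0 + 4) c" "4 \<le> N0 + 4"
    by (auto elim: arrays_below_mono)
  \<comment> \<open>At least 4, so that the four arrays filled by \<open>load_prog\<close> are
    cleaned even if the foreign program never writes to them.\<close>
  define N where "N = N0 + 4"
  \<comment> \<open>This is \<open>total_factor\<close> written out before any graph is fixed, which
    makes its independence of \<open>G\<close>, \<open>es\<close> and \<open>p\<close>
    explicit.\<close>
  define F where "F = 200 + 15 * K + N * (15 * (K + 2) + 3) + 520 + 30 * q + 74"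
  have "solves_partition_problem \<mu> (int q)
    (\<lambda>n m. F * 4 ^ (k + 3 + q) * max 1 n ^ (2 * (k + 3 + q)) * max 1 m) (partition_prog c N q)"
    unfolding solves_partition_problem_def
  proof (intro allI impI)
    fix G es p assume G: "simple_graph G" "edge_list_of G es"
    interpret listed_graph G es
      using G by unfold_locales
    have "exec c (load (encode_graph G es @ [encode_subset G X])) (K * s ^ k) (\<lambda>M. M 0 0 = int (\<mu> G X))"
      if X: "X \<subseteq> {..<n}" for X
    proof -
      obtain t M where run: "runs c (load (encode_graph G es @ [encode_subset G X])) t M"
        "M 0 0 = int (\<mu> G X)" "t \<le> K * (num_verts G + num_edges G + 1) ^ k"
        using calls[OF G, of X] X by (auto simp: verts_eq)
      have "K * (num_verts G + num_edges G + 1) ^ k \<le> K * s ^ k"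
        by (intro mult_le_mono2 power_mono) (auto simp: s_def num_edges_eq)
      from order_trans[OF run(3) this] run(2) show ?thesis
        by (intro execI[OF run(1)])
    qed
    then interpret computed_partition_search G es \<mu> p q c N K k
      using assms(1) N by unfold_locales (auto simp: N_def)
    have "total_factor * s ^ (k + 3 + q) \<le> F * (4 * max 1 n ^ 2) ^ (k + 3 + q)"
      using power_mono[OF s_le, of "k + 3 + q"]
      by (intro mult_le_mono) (auto simp: F_def total_factor_def visit_factor_def measure_factor_def)
    also have "\<dots> = F * 4 ^ (k + 3 + q) * max 1 n ^ (2 * (k + 3 + q)) * 1"
      by (simp only: power_mult_distrib power_mult mult.assoc mult_1_right)
    also have "\<dots> \<le> F * 4 ^ (k + 3 + q) * max 1 n ^ (2 * (k + 3 + q)) * max 1 (num_edges G)"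
      by (rule mult_le_mono2) simp
    finally show "\<exists>t M. runs (partition_prog c N q) (load (encode_graph G es @ [[p]])) t M \<and>
        correct_answer \<mu> p (int q) G M \<and>
        t \<le> F * 4 ^ (k + 3 + q) * max 1 (num_verts G) ^ (2 * (k + 3 + q)) * max 1 (num_edges G)"
      using exec_partition unfolding exec_def by (blast intro: order_trans)
  qed
  then show ?thesis by blast
qed

text \<open>Cut degrees are nonnegative, so for negative \<open>q\<close> only the empty graph has a partition.\<close>

lemma solves_neg:
  assumes "q < 0"
  shows "solves_partition_problem \<mu> q (\<lambda>n m. 10 * max 1 n ^ g * max 1 m)
    (IfPos vertex_count (Store 0 (Const 0) (Const 0)) (Store 0 (Const 0) (Const 1)))"
    (is "solves_partition_problem _ _ _ ?c")
  unfolding solves_partition_problem_def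
proof (intro allI impI)
  fix G es p assume "simple_graph G" "edge_list_of G es"
  let ?M = "load (encode_graph G es @ [[p]])"
  have no_cluster: "\<not> is_cluster \<mu> p q G C" for C
    using assms by (simp add: is_cluster_def)
  have n: "?M 0 0 = int (num_verts G)"
    by (simp add: load_def encode_graph_def)
  have "exec ?c ?M 10 (correct_answer \<mu> p q G)"
  proof (rule exec_loop_free)
    show "correct_answer \<mu> p q G (result ?c ?M)"
    proof (cases "num_verts G = 0")
      case True
      then have "verts G = {}"
        by (simp add: num_verts_def verts_def)
      then show ?thesis
        using True n
        by (auto simp: correct_answer_def is_cluster_partition_def label_classes_def no_cluster
            partition_on_def)
    next
      case False
      then have "verts G \<noteq> {}"
        by (auto simp: num_verts_def)
      then have "\<not> is_cluster_partition \<mu> p q G P" for P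
        by (auto simp: is_cluster_partition_def no_cluster partition_on_def)
      then show ?thesis
        using False n by (simp add: correct_answer_def)
    qed
  qed simp_all
  moreover have "10 * 1 * 1 \<le> 10 * max 1 (num_verts G) ^ g * max 1 (num_edges G)"
    by (intro mult_le_mono) auto
  ultimately show "\<exists>t M. runs ?c ?M t M \<and> correct_answer \<mu> p q G M \<and>
      t \<le> 10 * max 1 (num_verts G) ^ g * max 1 (num_edges G)"
    unfolding exec_def by (metis (no_types, lifting) mult_1_right order_trans)
qed

theorem theorem2:
  fixes \<mu> :: "graph \<Rightarrow> nat set \<Rightarrow> nat"
  assumes "monotone_measure \<mu>" and "poly_time_computable \<mu>"
  shows "\<exists>g :: int \<Rightarrow> nat. (\<lambda>q. real (g q)) \<in> O(\<lambda>q. real_of_int q) \<and>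
           (\<forall>q. \<exists>c K. solves_partition_problem \<mu> q (\<lambda>n m. K * max 1 n ^ g q * max 1 m) c)"
proof -
  obtain c K k where calls: "\<And>G es X. simple_graph G \<Longrightarrow> edge_list_of G es \<Longrightarrow> X \<subseteq> verts G \<Longrightarrow>
      \<exists>t M. runs c (load (encode_graph G es @ [encode_subset G X])) t M \<and>
        M 0 0 = int (\<mu> G X) \<and> t \<le> K * (num_verts G + num_edges G + 1) ^ k"
    using assms(2) unfolding poly_time_computable_def by blast
  define g where "g q = 2 * (k + 3 + nat q)" for q
  have "(\<lambda>q. real (g q)) \<in> O(\<lambda>q. real_of_int q)"
  proof (rule bigoI)
    \<comment> \<open>For \<open>q \<ge> 1\<close> the constant part \<open>2 * k + 6\<close> of
      \<open>g q\<close> is at most \<open>(2 * k + 6) * q\<close>, and \<open>2 * q\<close> is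
      added.\<close>
    have "norm (real (g q)) \<le> (2 * real k + 8) * norm (real_of_int q)" if "q \<ge> 1" for q
    proof -
      have "2 * real k + 6 \<le> (2 * real k + 6) * real_of_int q"
        using that by simp
      then show ?thesis
        using that by (simp add: g_def algebra_simps)
    qed
    then show "\<forall>\<^sub>F q in at_top. norm (real (g q)) \<le> (2 * real k + 8) * norm (real_of_int q)"
      by (auto intro: eventually_at_top_linorderI[of 1])
  qed
  moreover have "\<exists>c K. solves_partition_problem \<mu> q (\<lambda>n m. K * max 1 n ^ g q * max 1 m) c" for q
  proof (cases "q < 0")
    case True
    then show ?thesis using solves_neg by blast
  next
    case False
    then show ?thesis
      using solves_nonneg[OF assms(1) calls, of "nat q"] by (simp add: g_def)
  qed
  ultimately show ?thesis by blast
qed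

end
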